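(* Let $n\ge 1$ and let $\mathcal F\subseteq 2^{[n]}$ be a union-closed family containing at least one nonempty set. Let $p=\max_{1\le i\le n}p_i$, where $p_i=|\{A\in\mathcal F: i\in A\}|/|\mathcal F|$. Then $$p\ \ge\ \frac{1531541}{4000000}=0.38288525.$$
   Context: $[n]=\{1,\dots,n\}$. A family $\mathcal F\subseteq 2^{[n]}$ (a set of distinct subsets of $[n]$) is union-closed if $A\cup B\in\mathcal F$ whenever $A,B\in\mathcal F$. *)

theory Defs
  imports Complex_Main
begin

definition union_closed :: "'a set set \<Rightarrow> bool" where
  "union_closed F \<longleftrightarrow> (\<forall>A\<in>F. \<forall>B\<in>F. A \<union> B \<in> F)"

definition frequency :: "'a set set \<Rightarrow> 'a \<Rightarrow> real" where
  "frequency F i = real (card {A \<in> F. i \<in> A}) / real (card F)"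

end

theory Submission
  imports Defs "HOL-Analysis.Harmonic_Numbers" "HOL-Computational_Algebra.Polynomial"
begin

text \<open>
  Entropy proof with two couplings. Let $A$ and $B$ be uniformly distributed members of the
  family $F$, revealed one element at a time. Write $h$ for the binary entropy, and let $s$ and $t$
  be the conditional probabilities, given what has been revealed of $A$ and of $B$, that the next
  element $i$ avoids $A$ and that it avoids $B$. A coupling chooses the conditional probability
  $q(s,t)$ that $i$ avoids $A \cup B$. Since $A \cup B$ lies in $F$, every coupling satisfies
  $\ln |F| \ge \sum_i E\, h(q(s,t))$ (\<open>entropy_of_unions\<close>), whereas
  $\ln |F| = \sum_i E\, h(s)$ (\<open>entropy_chain_rule\<close>).

  The independent coupling has $q = st$. Put \<open>gap s t = s h(t) + t h(s) - h(st)\<close>. Because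
  $E\, s = 1 - p_i$ and $s$, $t$ are independent there,
  $E\,[h(st) + \mathrm{gap}(s,t)] = 2 (1 - p_i) E\, h(s)$. So it would suffice to pay for
  $E\,\mathrm{gap}$ with a multiple \<open>gain\<close> of a second copy of $\ln |F|$: if
  \<open>gain\<close> $\cdot \ln |F|$ is at least the sum of $E\,\mathrm{gap}$, then
  $(1 + \mathrm{gain}) \ln |F| \ge \sum_i 2 (1 - p_i) E\, h(s)$, and unless $|F| = 1$ some $p_i$ is
  at least $(1 - \mathrm{gain})/2$, which is the stated constant.

  The payment comes from a second, positively correlated coupling, in two steps. First, the gap is a
  positive semidefinite kernel,
  $\mathrm{gap}(s,t) = \sum_{k \ge 2} (s - s^k)(t - t^k) / (k (k-1))$ (\<open>gap_sums\<close>), and the joint law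
  produced by a coupling with $q(s,t) = st + \psi(s)\psi(t)$ gives every such kernel an
  expectation at least as large as the independent law does (\<open>pair_mean_gap_mono\<close>). Second, for
  a suitable $\psi$ the pointwise inequality $\mathrm{gap}(s,t) \le \mathrm{gain} \cdot h(q(s,t))$
  holds (\<open>coupling_covers_gap\<close>).

  The pointwise inequality is two-dimensional, but the Cauchy-Schwarz inequality for the gap and
  the concavity of $u \mapsto \ln h(e^u)$ reduce it to the diagonal $s = t$. The correlation makes
  $q(s,t) = \kappa st$ with $\kappa$ = \<open>boost\<close> when $s, t \le 17/20$, and $q = st$ otherwise,
  so that there remain
  $\mathrm{gap}(t,t) \le \mathrm{gain} \cdot h(\kappa t^2)$ for $t \le 17/20$ and
  $\kappa\,\mathrm{gap}(t,t) \le \mathrm{gain} \cdot h(t^2)$ for $t \ge 17/20$. The number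
  \<open>gain\<close> exceeds the maximum of $\mathrm{gap}(t,t)/\ln 2$, attained near $t = 0.6909$, by only
  about $2 \cdot 10^{-8}$; $\kappa$ is chosen so that $\kappa t^2$ is close to $1/2$ there, where
  $h$ is largest. The first inequality is therefore nearly an equality at that point, and its proof
  needs accurate logarithms; elsewhere crude polynomial bounds are enough.
\<close>

section \<open>Families of sets revealed element by element\<close>

definition bin_entropy :: "real \<Rightarrow> real" where
  "bin_entropy t = - t * ln t - (1 - t) * ln (1 - t)"

definition avoiding :: "'a \<Rightarrow> 'a set set \<Rightarrow> 'a set set" where
  "avoiding i G = {A \<in> G. i \<notin> A}"

definition containing :: "'a \<Rightarrow> 'a set set \<Rightarrow> 'a set set" where
  "containing i G = {A \<in> G. i \<in> A}"

text \<open>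
  The conditional probability that \<open>i\<close> avoids a uniformly chosen member of \<open>G\<close>. The subfamily \<open>G\<close>
  stands for the history: it consists of the members of the original family that agree with what has
  been revealed. On an empty family the value is \<open>0 / 0 = 0\<close>; empty families only ever occur with
  weight zero.
\<close>

definition absence :: "'a \<Rightarrow> 'a set set \<Rightarrow> real" where
  "absence i G = real (card (avoiding i G)) / real (card G)"

definition branch :: "'a \<Rightarrow> ('a set set \<Rightarrow> real) \<Rightarrow> 'a set set \<Rightarrow> real" where
  "branch i f G = absence i G * f (avoiding i G) + (1 - absence i G) * f (containing i G)"

text \<open>
  The mean of \<open>f\<close> over the histories in which the elements \<open>1, \<dots>, n\<close> have been revealed. The newest
  element is averaged innermost, so that going from \<open>n\<close> to \<open>Suc n\<close> only replaces the function.
\<close>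

fun prefix_mean :: "nat \<Rightarrow> (nat set set \<Rightarrow> real) \<Rightarrow> nat set set \<Rightarrow> real" where
  "prefix_mean 0 f = f"
| "prefix_mean (Suc n) f = prefix_mean n (branch (Suc n) f)"

text \<open>
  The probability that an element avoids both of two sets which it avoids with probabilities \<open>s\<close>
  and \<open>t\<close>. The covariance of the two events has rank one in \<open>(s, t)\<close>, which is what makes the
  coupled law dominate the independent one in \<open>pair_mean_square\<close>; \<open>\<psi> = 0\<close> is independence.
\<close>

definition both_absent :: "(real \<Rightarrow> real) \<Rightarrow> real \<Rightarrow> real \<Rightarrow> real" where
  "both_absent \<psi> s t = s * t + \<psi> s * \<psi> t"

definition pair_branch ::
    "(real \<Rightarrow> real) \<Rightarrow> 'a \<Rightarrow> ('a set set \<Rightarrow> 'a set set \<Rightarrow> real) \<Rightarrow> 'a set set \<Rightarrow> 'a set set \<Rightarrow> real" where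
  "pair_branch \<psi> i X G H =
     (let s = absence i G; t = absence i H; q = both_absent \<psi> s t in
        q * X (avoiding i G) (avoiding i H) + (s - q) * X (avoiding i G) (containing i H)
      + (t - q) * X (containing i G) (avoiding i H) + (1 - s - t + q) * X (containing i G) (containing i H))"

fun pair_mean ::
    "(real \<Rightarrow> real) \<Rightarrow> nat \<Rightarrow> (nat set set \<Rightarrow> nat set set \<Rightarrow> real) \<Rightarrow> nat set set \<Rightarrow> nat set set \<Rightarrow> real" where
  "pair_mean \<psi> 0 X = X"
| "pair_mean \<psi> (Suc n) X = pair_mean \<psi> n (pair_branch \<psi> (Suc n) X)"

text \<open>
  The Frechet bounds: exactly the condition that the four weights in \<open>pair_branch\<close> are nonnegative.
\<close>

definition admissible :: "(real \<Rightarrow> real) \<Rightarrow> bool" where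
  "admissible \<psi> \<longleftrightarrow> (\<forall>s\<in>{0..1}. \<forall>t\<in>{0..1}.
     max 0 (s + t - 1) \<le> both_absent \<psi> s t \<and> both_absent \<psi> s t \<le> min s t)"

definition family :: "'a set set \<Rightarrow> bool" where
  "family G \<longleftrightarrow> finite G \<and> G \<noteq> {}"

lemma finite_parts: "finite G \<Longrightarrow> finite (avoiding i G)" "finite G \<Longrightarrow> finite (containing i G)"
  by (simp_all add: avoiding_def containing_def)

lemma parts_empty: "avoiding i {} = {}" "containing i {} = {}"
  by (simp_all add: avoiding_def containing_def)

lemma card_parts: "finite G \<Longrightarrow> card (avoiding i G) + card (containing i G) = card G"
proof -
  assume "finite G"
  have "G = avoiding i G \<union> containing i G" "avoiding i G \<inter> containing i G = {}"
    by (auto simp: avoiding_def containing_def)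
  then show ?thesis using card_Un_disjoint[of "avoiding i G" "containing i G"] \<open>finite G\<close> finite_parts
    by metis
qed

lemma absence_bounds: "0 \<le> absence i G" "absence i G \<le> 1"
proof -
  show "0 \<le> absence i G" by (simp add: absence_def)
  show "absence i G \<le> 1"
  proof (cases "finite G")
    case True
    then have "card (avoiding i G) \<le> card G" by (intro card_mono) (auto simp: avoiding_def)
    then show ?thesis by (simp add: absence_def divide_le_eq)
  qed (simp add: absence_def)
qed

lemma absence_alt:
  assumes "family G"
  shows "real (card (avoiding i G)) = absence i G * card G"
    and "real (card (containing i G)) = (1 - absence i G) * card G"
proof -
  have c: "card G > 0" using assms by (simp add: family_def card_gt_0_iff)
  then show 1: "real (card (avoiding i G)) = absence i G * card G" by (simp add: absence_def)
  have "real (card (avoiding i G)) + real (card (containing i G)) = real (card G)"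
    using card_parts[of G i] assms unfolding family_def by (metis of_nat_add)
  then show "real (card (containing i G)) = (1 - absence i G) * card G"
    using 1 by (simp add: algebra_simps)
qed

lemma family_avoiding: "family G \<Longrightarrow> absence i G \<noteq> 0 \<Longrightarrow> family (avoiding i G)"
  by (auto simp: family_def finite_parts absence_def)

lemma family_containing: "family G \<Longrightarrow> absence i G \<noteq> 1 \<Longrightarrow> family (containing i G)"
  using absence_alt(2)[of G i] by (auto simp: family_def finite_parts)

lemma both_absent_bounds:
  assumes "admissible \<psi>" and "0 \<le> s" "s \<le> 1" "0 \<le> t" "t \<le> 1"
  shows "0 \<le> both_absent \<psi> s t" "both_absent \<psi> s t \<le> s" "both_absent \<psi> s t \<le> t"
    "s + t - 1 \<le> both_absent \<psi> s t"
  using assms unfolding admissible_def by force+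

lemma branch_mono:
  assumes "\<And>G. family G \<Longrightarrow> f G \<le> g G" and "family G"
  shows "branch i f G \<le> branch i g G"
proof -
  have "absence i G * f (avoiding i G) \<le> absence i G * g (avoiding i G)"
    using assms(1)[of "avoiding i G"] family_avoiding[OF assms(2), of i] absence_bounds[of i G]
    by (cases "absence i G = 0") (auto intro!: mult_left_mono)
  moreover have "(1 - absence i G) * f (containing i G) \<le> (1 - absence i G) * g (containing i G)"
    using assms(1)[of "containing i G"] family_containing[OF assms(2), of i] absence_bounds[of i G]
    by (cases "absence i G = 1") (auto intro!: mult_left_mono)
  ultimately show ?thesis by (simp add: branch_def)
qed

lemma prefix_mean_mono:
  assumes "\<And>G. family G \<Longrightarrow> f G \<le> g G" and "family G"
  shows "prefix_mean n f G \<le> prefix_mean n g G"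
  using assms
proof (induction n arbitrary: f g)
  case (Suc n)
  have "prefix_mean n (branch (Suc n) f) G \<le> prefix_mean n (branch (Suc n) g) G"
    by (rule Suc.IH) (rule branch_mono, rule Suc.prems, assumption+, rule Suc.prems)
  then show ?case by simp
qed simp

lemma prefix_mean_cong: "(\<And>G. family G \<Longrightarrow> f G = g G) \<Longrightarrow> family G \<Longrightarrow> prefix_mean n f G = prefix_mean n g G"
  by (intro antisym prefix_mean_mono) auto

lemma branch_add: "branch i (\<lambda>G. f G + g G) = (\<lambda>G. branch i f G + branch i g G)"
  by (simp add: branch_def fun_eq_iff algebra_simps)

lemma prefix_mean_add: "prefix_mean n (\<lambda>G. f G + g G) = (\<lambda>G. prefix_mean n f G + prefix_mean n g G)"
  by (induction n arbitrary: f g) (simp_all add: branch_add)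

lemma pair_branch_mono:
  assumes "admissible \<psi>" and "\<And>G H. family G \<Longrightarrow> family H \<Longrightarrow> X G H \<le> Y G H"
    and "family G" "family H"
  shows "pair_branch \<psi> i X G H \<le> pair_branch \<psi> i Y G H"
proof -
  define s t where "s = absence i G" and "t = absence i H"
  define q where "q = both_absent \<psi> s t"
  have st: "0 \<le> s" "s \<le> 1" "0 \<le> t" "t \<le> 1" by (auto simp: s_def t_def absence_bounds)
  note w = both_absent_bounds[OF assms(1) st, folded q_def]
  have *: "w * X A B \<le> w * Y A B" if "0 \<le> w" "w \<noteq> 0 \<Longrightarrow> family A \<and> family B" for w A B
    using that assms(2) by (cases "w = 0") (auto intro!: mult_left_mono)
  have "q * X (avoiding i G) (avoiding i H) \<le> q * Y (avoiding i G) (avoiding i H)"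
    using w st family_avoiding[OF assms(3)] family_avoiding[OF assms(4)]
    by (intro *) (fastforce simp: s_def t_def)+
  moreover have "(s - q) * X (avoiding i G) (containing i H) \<le> (s - q) * Y (avoiding i G) (containing i H)"
    using w st family_avoiding[OF assms(3)] family_containing[OF assms(4)]
    by (intro *) (fastforce simp: s_def t_def)+
  moreover have "(t - q) * X (containing i G) (avoiding i H) \<le> (t - q) * Y (containing i G) (avoiding i H)"
    using w st family_containing[OF assms(3)] family_avoiding[OF assms(4)]
    by (intro *) (fastforce simp: s_def t_def)+
  moreover have "(1 - s - t + q) * X (containing i G) (containing i H) \<le> (1 - s - t + q) * Y (containing i G) (containing i H)"
    using w st family_containing[OF assms(3)] family_containing[OF assms(4)]
    by (intro *) (fastforce simp: s_def t_def)+
  ultimately show ?thesis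
    by (simp add: pair_branch_def Let_def flip: s_def t_def q_def)
qed

lemma pair_mean_mono:
  assumes "admissible \<psi>" and "\<And>G H. family G \<Longrightarrow> family H \<Longrightarrow> X G H \<le> Y G H"
    and "family G" "family H"
  shows "pair_mean \<psi> n X G H \<le> pair_mean \<psi> n Y G H"
  using assms(2-4)
proof (induction n arbitrary: X Y)
  case (Suc n)
  have "pair_mean \<psi> n (pair_branch \<psi> (Suc n) X) G H \<le> pair_mean \<psi> n (pair_branch \<psi> (Suc n) Y) G H"
    by (rule Suc.IH) (rule pair_branch_mono[OF assms(1)], rule Suc.prems, assumption+, (rule Suc.prems)+)
  then show ?case by simp
qed simp

lemma pair_branch_add:
  "pair_branch \<psi> i (\<lambda>G H. X G H + Y G H) = (\<lambda>G H. pair_branch \<psi> i X G H + pair_branch \<psi> i Y G H)"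
  by (simp add: pair_branch_def Let_def fun_eq_iff algebra_simps)

lemma pair_mean_add:
  "pair_mean \<psi> n (\<lambda>G H. X G H + Y G H) = (\<lambda>G H. pair_mean \<psi> n X G H + pair_mean \<psi> n Y G H)"
  by (induction n arbitrary: X Y) (simp_all add: pair_branch_add)

lemma pair_branch_scale: "pair_branch \<psi> i (\<lambda>G H. c * X G H) = (\<lambda>G H. c * pair_branch \<psi> i X G H)"
  by (simp add: pair_branch_def Let_def fun_eq_iff algebra_simps)

lemma pair_mean_scale: "pair_mean \<psi> n (\<lambda>G H. c * X G H) = (\<lambda>G H. c * pair_mean \<psi> n X G H)"
  by (induction n arbitrary: X) (simp_all add: pair_branch_scale)

lemma pair_mean_sums:
  assumes "\<And>G H. (\<lambda>k. X k G H) sums Y G H"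
  shows "(\<lambda>k. pair_mean \<psi> n (X k) G H) sums pair_mean \<psi> n Y G H"
  using assms
proof (induction n arbitrary: X Y)
  case (Suc n)
  have "(\<lambda>k. pair_branch \<psi> (Suc n) (X k) G H) sums pair_branch \<psi> (Suc n) Y G H" for G H
    unfolding pair_branch_def Let_def by (intro sums_add sums_mult Suc.prems)
  then show ?case using Suc.IH by simp
qed simp

text \<open>
  The weights of the coupling split into the independent ones and a rank one correction, which acts
  on product functions by differencing both factors.
\<close>

lemma pair_branch_product:
  "pair_branch \<psi> i (\<lambda>G H. f G * g H) G H = branch i f G * branch i g H
   + (\<psi> (absence i G) * (f (avoiding i G) - f (containing i G))) *
     (\<psi> (absence i H) * (g (avoiding i H) - g (containing i H)))"
  by (simp add: pair_branch_def branch_def both_absent_def Let_def algebra_simps)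

lemma pair_mean_independent:
  "pair_mean (\<lambda>_. 0) n (\<lambda>G H. f G * g H) G H = prefix_mean n f G * prefix_mean n g H"
proof (induction n arbitrary: f g)
  case (Suc n)
  have "pair_branch (\<lambda>_. 0) (Suc n) (\<lambda>G H. f G * g H) = (\<lambda>G H. branch (Suc n) f G * branch (Suc n) g H)"
    by (simp add: pair_branch_product fun_eq_iff)
  then show ?case using Suc.IH by simp
qed simp

text \<open>
  Each coupling makes a function positively correlated with itself: in \<open>pair_branch_product\<close> the
  correction term is again a product of a function with itself, so its mean is nonnegative by
  induction.
\<close>

lemma pair_mean_square:
  "(prefix_mean n f F)\<^sup>2 \<le> pair_mean \<psi> n (\<lambda>G H. f G * f H) F F"
proof (induction n arbitrary: f)
  case (Suc n)
  define f' where "f' = (\<lambda>G. \<psi> (absence (Suc n) G) * (f (avoiding (Suc n) G) - f (containing (Suc n) G)))"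
  have "pair_branch \<psi> (Suc n) (\<lambda>G H. f G * f H)
      = (\<lambda>G H. branch (Suc n) f G * branch (Suc n) f H + f' G * f' H)"
    by (simp add: pair_branch_product fun_eq_iff f'_def)
  then have "pair_mean \<psi> (Suc n) (\<lambda>G H. f G * f H) F F
     = pair_mean \<psi> n (\<lambda>G H. branch (Suc n) f G * branch (Suc n) f H) F F
       + pair_mean \<psi> n (\<lambda>G H. f' G * f' H) F F"
    by (simp add: pair_mean_add)
  moreover have "(prefix_mean n (branch (Suc n) f) F)\<^sup>2
      \<le> pair_mean \<psi> n (\<lambda>G H. branch (Suc n) f G * branch (Suc n) f H) F F"
    by (rule Suc.IH)
  moreover have "0 \<le> pair_mean \<psi> n (\<lambda>G H. f' G * f' H) F F"
    using Suc.IH[of f'] zero_le_power2 order_trans by blast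
  ultimately show ?case by simp
qed (simp add: power2_eq_square)

section \<open>Entropy of a union\<close>

text \<open>
  Gibbs' inequality for two outcomes. It replaces the chain rule and the maximality of the uniform
  distribution at once: with \<open>a\<close> and \<open>b\<close> the sizes of the two halves of a family, it bounds the
  logarithm of the total size below by one step of an entropy.
\<close>

lemma ln_add_ge:
  fixes a b :: nat
  assumes "0 \<le> q" "q \<le> 1" "q \<noteq> 0 \<Longrightarrow> a > 0" "q \<noteq> 1 \<Longrightarrow> b > 0"
  shows "bin_entropy q + q * ln a + (1 - q) * ln b \<le> ln (a + b)"
proof -
  consider "q = 0" | "q = 1" | "0 < q" "q < 1" using assms by linarith
  then show ?thesis
  proof cases
    case 1
    then show ?thesis using assms by (simp add: bin_entropy_def)
  next
    case 2
    then show ?thesis using assms by (simp add: bin_entropy_def)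
  next
    case 3
    define u v where "u = real a" "v = real b"
    have uv: "u > 0" "v > 0" using 3 assms by (auto simp: u_v_def)
    have 1: "ln (u / (q * (u + v))) \<le> u / (q * (u + v)) - 1"
      using uv 3 by (intro ln_le_minus_one) (simp add: add_pos_pos)
    have 2: "ln (v / ((1 - q) * (u + v))) \<le> v / ((1 - q) * (u + v)) - 1"
      using uv 3 by (intro ln_le_minus_one) (simp add: add_pos_pos)
    have "q * ln (u / (q * (u + v))) + (1 - q) * ln (v / ((1 - q) * (u + v)))
       \<le> q * (u / (q * (u + v)) - 1) + (1 - q) * (v / ((1 - q) * (u + v)) - 1)"
      using 1 2 3 by (intro add_mono mult_left_mono) auto
    also have "\<dots> = u / (u + v) + v / (u + v) - 1"
      using 3 uv by (simp add: right_diff_distrib)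
    also have "\<dots> = 0" using uv by (simp flip: add_divide_distrib)
    finally have "q * ln (u / (q * (u + v))) + (1 - q) * ln (v / ((1 - q) * (u + v))) \<le> 0" .
    moreover have e1: "ln (u / (q * (u + v))) = ln u - ln q - ln (u + v)"
      using uv 3 by (simp add: ln_div ln_mult add_pos_pos)
    moreover have e2: "ln (v / ((1 - q) * (u + v))) = ln v - ln (1 - q) - ln (u + v)"
      using uv 3 by (simp add: ln_div ln_mult add_pos_pos)
    ultimately have "q * (ln u - ln q - ln (u + v)) + (1 - q) * (ln v - ln (1 - q) - ln (u + v)) \<le> 0"
      by (simp only: e1 e2)
    then have "bin_entropy q + q * ln u + (1 - q) * ln v \<le> ln (u + v)"
      unfolding bin_entropy_def by (simp add: algebra_simps)
    then show ?thesis by (simp add: u_v_def)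
  qed
qed

text \<open>
  The case of equality in Gibbs' inequality: a uniformly chosen member splits in the proportion of
  the two halves.
\<close>

lemma ln_card_split:
  assumes "family G"
  shows "ln (card G) = bin_entropy (absence i G) + branch i (\<lambda>G. ln (card G)) G"
proof -
  define s where "s = absence i G"
  have c: "real (card G) > 0" using assms by (simp add: family_def card_gt_0_iff)
  have s: "0 \<le> s" "s \<le> 1" by (auto simp: s_def absence_bounds)
  have e1: "s * ln (card (avoiding i G)) = s * (ln s + ln (card G))"
    using c s absence_alt[OF assms, of i] by (cases "s = 0") (auto simp: ln_mult simp flip: s_def)
  have e2: "(1 - s) * ln (card (containing i G)) = (1 - s) * (ln (1 - s) + ln (card G))"
    using c s absence_alt[OF assms, of i] by (cases "s = 1") (auto simp: ln_mult simp flip: s_def)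
  show ?thesis
    unfolding branch_def bin_entropy_def s_def[symmetric] e1 e2 by (simp add: algebra_simps)
qed

definition unions :: "'a set set \<Rightarrow> 'a set set \<Rightarrow> 'a set set" where
  "unions G H = (\<lambda>(A, B). A \<union> B) ` (G \<times> H)"

lemma unions_memI: "A \<in> G \<Longrightarrow> B \<in> H \<Longrightarrow> A \<union> B \<in> unions G H"
  by (force simp: unions_def)

lemma family_unions: "family G \<Longrightarrow> family H \<Longrightarrow> family (unions G H)"
  unfolding family_def unions_def by blast

lemma ln_card_mono: "A \<subseteq> B \<Longrightarrow> family B \<Longrightarrow> ln (real (card A)) \<le> ln (real (card B))"
proof (cases "A = {}")
  case True
  assume "family B"
  then have "card B \<ge> 1" by (simp add: family_def card_gt_0_iff Suc_le_eq)
  then show ?thesis using True by simp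
next
  case False
  assume "A \<subseteq> B" "family B"
  then show ?thesis using False
    by (intro ln_mono) (auto simp: family_def card_gt_0_iff intro: card_mono finite_subset)
qed

text \<open>
  A union avoids \<open>i\<close> exactly if both members do, so the half of \<open>unions G H\<close> avoiding \<open>i\<close> contains the
  unions of one pair of halves, and the other half contains each of the three remaining families of
  unions. Gibbs' inequality is then applied with the probability \<open>both_absent\<close> as the proportion of
  the first half.
\<close>

lemma ln_card_unions_split:
  assumes "admissible \<psi>" "family G" "family H"
  shows "bin_entropy (both_absent \<psi> (absence i G) (absence i H))
       + pair_branch \<psi> i (\<lambda>G H. ln (card (unions G H))) G H \<le> ln (card (unions G H))"
proof -
  define s t where "s = absence i G" and "t = absence i H"
  define q where "q = both_absent \<psi> s t"
  define K where "K = unions G H"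
  define X where "X = (\<lambda>G H. ln (real (card (unions (G::'a set set) H))))"
  have K: "family K" unfolding K_def by (rule family_unions[OF assms(2,3)])
  have st: "0 \<le> s" "s \<le> 1" "0 \<le> t" "t \<le> 1" by (auto simp: s_def t_def absence_bounds)
  note w = both_absent_bounds[OF assms(1) st, folded q_def]
  have fG: "s \<noteq> 0 \<Longrightarrow> family (avoiding i G)" "s \<noteq> 1 \<Longrightarrow> family (containing i G)"
    using family_avoiding[OF assms(2)] family_containing[OF assms(2)] by (auto simp: s_def)
  have fH: "t \<noteq> 0 \<Longrightarrow> family (avoiding i H)" "t \<noteq> 1 \<Longrightarrow> family (containing i H)"
    using family_avoiding[OF assms(3)] family_containing[OF assms(3)] by (auto simp: t_def)
  have sub0: "unions (avoiding i G) (avoiding i H) \<subseteq> avoiding i K"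
    by (auto simp: unions_def K_def avoiding_def)
  have sub1: "unions (avoiding i G) (containing i H) \<subseteq> containing i K"
      "unions (containing i G) (avoiding i H) \<subseteq> containing i K"
      "unions (containing i G) (containing i H) \<subseteq> containing i K"
    by (auto simp: unions_def K_def avoiding_def containing_def)
  have famI: "family B" if "A \<subseteq> B" "family A" "B \<subseteq> K" for A B
    using that K by (auto simp: family_def intro: finite_subset)
  have K0: "family (avoiding i K)" if "q \<noteq> 0"
    by (rule famI[OF sub0]) (use that w st fG fH in \<open>auto intro!: family_unions simp: avoiding_def\<close>)
  \<comment> \<open>if the union may contain \<open>i\<close>, one of the three pairs of halves producing such unions is nonempty\<close>
  have K1: "family (containing i K)" if "q \<noteq> 1"
  proof -
    have "(s \<noteq> 0 \<and> t \<noteq> 1) \<or> (s \<noteq> 1 \<and> t \<noteq> 0) \<or> (s \<noteq> 1 \<and> t \<noteq> 1)"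
      using that w st by linarith
    then show ?thesis
      using fG fH famI[OF sub1(1)] famI[OF sub1(2)] famI[OF sub1(3)]
      by (metis (lifting) family_unions containing_def mem_Collect_eq subsetI)
  qed
  have le: "c * X A B \<le> c * ln (card J)" if "0 \<le> c" "c \<noteq> 0 \<Longrightarrow> family J" "unions A B \<subseteq> J" for c A B J
    using that ln_card_mono[of "unions A B" J]
    by (cases "c = 0") (auto simp: X_def intro!: mult_left_mono)
  have t0: "q * X (avoiding i G) (avoiding i H) \<le> q * ln (card (avoiding i K))"
    using w K0 by (intro le sub0) auto
  have t1: "(s - q) * X (avoiding i G) (containing i H) \<le> (s - q) * ln (card (containing i K))"
    using w K1 st by (intro le sub1) auto
  have t2: "(t - q) * X (containing i G) (avoiding i H) \<le> (t - q) * ln (card (containing i K))"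
    using w K1 st by (intro le sub1) auto
  have t3: "(1 - s - t + q) * X (containing i G) (containing i H) \<le> (1 - s - t + q) * ln (card (containing i K))"
    using w K1 st by (intro le sub1) auto
  have "pair_branch \<psi> i X G H \<le> q * ln (card (avoiding i K)) + (1 - q) * ln (card (containing i K))"
    using add_mono[OF add_mono[OF add_mono[OF t0 t1] t2] t3]
    by (simp add: pair_branch_def Let_def algebra_simps flip: s_def t_def q_def)
  moreover have "bin_entropy q + q * ln (card (avoiding i K)) + (1 - q) * ln (card (containing i K))
     \<le> ln (real (card (avoiding i K)) + real (card (containing i K)))"
    using w st K0 K1 ln_add_ge[of q "card (avoiding i K)" "card (containing i K)"]
    by (simp add: family_def card_gt_0_iff)
  moreover have "real (card (avoiding i K)) + real (card (containing i K)) = real (card K)"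
    using K card_parts[of K i] by (simp add: family_def flip: of_nat_add)
  ultimately show ?thesis by (simp add: X_def K_def s_def t_def q_def)
qed

text \<open>
  Telescoping \<open>ln_card_unions_split\<close>, starting from \<open>unions F F = F\<close>.
\<close>

lemma entropy_of_unions:
  assumes "admissible \<psi>" "family F" "union_closed F"
  shows "(\<Sum>i<n. pair_mean \<psi> i
            (\<lambda>G H. bin_entropy (both_absent \<psi> (absence (Suc i) G) (absence (Suc i) H))) F F)
         \<le> ln (card F)"
proof -
  define X where "X = (\<lambda>G H. ln (real (card (unions (G::nat set set) H))))"
  define h where "h = (\<lambda>i G H. bin_entropy (both_absent \<psi> (absence (Suc i) G) (absence (Suc i) H)))"
  have telescope: "(\<Sum>i<n. pair_mean \<psi> i (h i) F F) + pair_mean \<psi> n X F F \<le> X F F" for n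
  proof (induction n)
    case (Suc n)
    have "pair_mean \<psi> n (\<lambda>G H. h n G H + pair_branch \<psi> (Suc n) X G H) F F \<le> pair_mean \<psi> n X F F"
      unfolding h_def X_def
      by (intro pair_mean_mono[OF assms(1)] ln_card_unions_split assms)
    then show ?case using Suc by (simp add: pair_mean_add)
  qed simp
  have "pair_mean \<psi> n (\<lambda>_ _. 0) F F = 0"
    using pair_mean_scale[of \<psi> n 0 "\<lambda>_ _. 0"] by simp
  moreover have "pair_mean \<psi> n (\<lambda>_ _. 0) F F \<le> pair_mean \<psi> n X F F"
  proof (intro pair_mean_mono[OF assms(1)] assms)
    fix G H :: "nat set set"
    assume "family G" "family H"
    then have "family (unions G H)" by (rule family_unions)
    then have "card (unions G H) > 0" by (simp add: family_def card_gt_0_iff)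
    then show "0 \<le> X G H" by (simp add: X_def Suc_le_eq)
  qed
  moreover have "unions F F = F"
  proof
    show "unions F F \<subseteq> F" using assms(3) by (auto simp: unions_def union_closed_def)
    show "F \<subseteq> unions F F"
    proof
      fix A assume "A \<in> F"
      then show "A \<in> unions F F" using unions_memI[of A F A F] by simp
    qed
  qed
  ultimately have "(\<Sum>i<n. pair_mean \<psi> i (h i) F F) \<le> X F F" and "X F F = ln (card F)"
    using telescope[of n] by (linarith, simp add: X_def)
  then show ?thesis by (simp add: h_def)
qed

lemma prefix_mean_vanish:
  assumes "\<And>G. G \<subseteq> F \<Longrightarrow> (\<And>A B. A \<in> G \<Longrightarrow> B \<in> G \<Longrightarrow> A \<inter> {1..n} = B \<inter> {1..n}) \<Longrightarrow> f G = 0"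
  shows "prefix_mean n f F = 0"
  using assms
proof (induction n arbitrary: f)
  case 0
  then show ?case by simp
next
  case (Suc n)
  have "branch (Suc n) f G = 0"
    if G: "G \<subseteq> F" "\<And>A B. A \<in> G \<Longrightarrow> B \<in> G \<Longrightarrow> A \<inter> {1..n} = B \<inter> {1..n}" for G
  proof -
    have *: "f G' = 0" if G': "G' \<subseteq> G" "\<And>A B. A \<in> G' \<Longrightarrow> B \<in> G' \<Longrightarrow> Suc n \<in> A \<longleftrightarrow> Suc n \<in> B" for G'
    proof (rule Suc.prems)
      show "G' \<subseteq> F" using G'(1) G(1) by (rule subset_trans)
      fix A B assume AB: "A \<in> G'" "B \<in> G'"
      have "A \<inter> {1..Suc n} = A \<inter> {1..n} \<union> A \<inter> {Suc n}" for A :: "nat set" by auto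
      moreover have "A \<inter> {1..n} = B \<inter> {1..n}" using AB G'(1) by (intro G(2)) auto
      moreover have "A \<inter> {Suc n} = B \<inter> {Suc n}" using G'(2)[OF AB] by auto
      ultimately show "A \<inter> {1..Suc n} = B \<inter> {1..Suc n}" by metis
    qed
    have "f (avoiding (Suc n) G) = 0" by (rule *) (auto simp: avoiding_def)
    moreover have "f (containing (Suc n) G) = 0" by (rule *) (auto simp: containing_def)
    ultimately show ?thesis by (simp add: branch_def)
  qed
  then have "prefix_mean n (branch (Suc n) f) F = 0" by (rule Suc.IH)
  then show ?case by simp
qed

lemma entropy_chain_rule:
  assumes "family F" "F \<subseteq> Pow {1..n}"
  shows "ln (card F) = (\<Sum>i<n. prefix_mean i (\<lambda>G. bin_entropy (absence (Suc i) G)) F)"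
proof -
  define X where "X = (\<lambda>G. ln (real (card (G::nat set set))))"
  have telescope: "X F = (\<Sum>i<m. prefix_mean i (\<lambda>G. bin_entropy (absence (Suc i) G)) F) + prefix_mean m X F" for m
  proof (induction m)
    case (Suc m)
    have "prefix_mean m X F = prefix_mean m (\<lambda>G. bin_entropy (absence (Suc m) G) + branch (Suc m) X G) F"
      unfolding X_def by (intro prefix_mean_cong ln_card_split assms)
    then show ?case using Suc by (simp add: prefix_mean_add)
  qed simp
  have "prefix_mean n X F = 0"
  proof (rule prefix_mean_vanish)
    fix G assume G: "G \<subseteq> F" "\<And>A B. A \<in> G \<Longrightarrow> B \<in> G \<Longrightarrow> A \<inter> {1..n} = B \<inter> {1..n}"
    have "A = B" if "A \<in> G" "B \<in> G" for A B
      using G(2)[OF that] that G(1) assms(2) by blast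
    then have "G = {} \<or> (\<exists>A. G = {A})" by blast
    then show "X G = 0" by (auto simp: X_def)
  qed
  then show ?thesis using telescope[of n] by (simp add: X_def)
qed

text \<open>
  The law of total probability: revealing other elements does not change the overall frequency of
  \<open>j\<close>.
\<close>

lemma prefix_mean_absence:
  assumes "family F"
  shows "prefix_mean n (absence j) F = absence j F"
proof (induction n)
  case (Suc n)
  have "branch (Suc n) (absence j) G = absence j G" if G: "family G" for G
  proof -
    let ?i = "Suc n"
    have "card (avoiding j G) = card (avoiding j (avoiding ?i G)) + card (avoiding j (containing ?i G))"
      using card_parts[of "avoiding j G" ?i] G
      by (simp add: family_def finite_parts avoiding_def containing_def conj_commute conj_left_commute)
    moreover have "absence ?i G * absence j (avoiding ?i G) = card (avoiding j (avoiding ?i G)) / card G"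
    proof (cases "avoiding ?i G = {}")
      case False
      then have "real (card (avoiding ?i G)) \<noteq> 0" using G by (simp add: family_def finite_parts)
      then show ?thesis by (simp add: absence_def)
    qed (simp add: absence_def parts_empty)
    moreover have "(1 - absence ?i G) * absence j (containing ?i G) = card (avoiding j (containing ?i G)) / card G"
    proof (cases "containing ?i G = {}")
      case False
      then have "real (card (containing ?i G)) \<noteq> 0" "real (card G) \<noteq> 0"
        using G by (auto simp: family_def finite_parts)
      moreover have "1 - absence ?i G = card (containing ?i G) / card G"
        using absence_alt(2)[OF G, of ?i] G by (simp add: family_def)
      ultimately show ?thesis by (simp add: absence_def[of j])
    qed (simp add: absence_def[of j] parts_empty)
    ultimately show ?thesis by (simp add: branch_def absence_def[of j G] add_divide_distrib)
  qed
  then have "prefix_mean n (branch (Suc n) (absence j)) F = prefix_mean n (absence j) F"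
    by (intro prefix_mean_cong assms)
  then show ?case using Suc by simp
qed simp

section \<open>The gap kernel\<close>

lemma unit_fraction_diff: "1 / real (k + 1) - 1 / real (k + 2) = 1 / real ((k + 2) * (k + 1))"
  by (subst diff_frac_eq) (simp_all add: algebra_simps)

lemma one_minus_ln_sums:
  fixes u :: real
  assumes "\<bar>u\<bar> < 1"
  shows "(\<lambda>k. u ^ (k + 2) / ((k + 2) * (k + 1))) sums (u + (1 - u) * ln (1 - u))"
proof -
  have 0: "(\<lambda>n. u ^ n / n) sums (- ln (1 - u))"
    using sums_minus[OF ln_series'[of "- u"]] assms by simp
  have 1: "(\<lambda>n. u ^ (n + 1) / (n + 1)) sums (- ln (1 - u))"
    using 0 sums_Suc_iff[of "\<lambda>n. u ^ n / real n" "- ln (1 - u)"] by (simp add: add_ac)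
  have 2: "(\<lambda>n. u ^ (n + 2) / (n + 2)) sums (- ln (1 - u) - u)"
    using 1 sums_Suc_iff[of "\<lambda>n. u ^ (n + 1) / real (n + 1)" "- ln (1 - u) - u"] by (simp add: add_ac)
  have "(\<lambda>n. u * (u ^ (n + 1) / (n + 1)) - u ^ (n + 2) / (n + 2)) sums (u * (- ln (1 - u)) - (- ln (1 - u) - u))"
    by (intro sums_diff sums_mult 1 2)
  also have "(\<lambda>n. u * (u ^ (n + 1) / (n + 1)) - u ^ (n + 2) / (n + 2)) = (\<lambda>k. u ^ (k + 2) / ((k + 2) * (k + 1)))"
  proof
    fix n :: nat
    have "u ^ (n + 2) * (1 / real (n + 1) - 1 / real (n + 2)) = u ^ (n + 2) * (1 / real ((n + 2) * (n + 1)))"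
      by (simp only: unit_fraction_diff)
    then show "u * (u ^ (n + 1) / (n + 1)) - u ^ (n + 2) / (n + 2) = u ^ (n + 2) / ((n + 2) * (n + 1))"
      by (simp add: right_diff_distrib del: of_nat_mult of_nat_add)
  qed
  finally show ?thesis by (simp add: algebra_simps)
qed

text \<open>
  The amount by which \<open>h(st)\<close> falls short of the expression \<open>s h(t) + t h(s)\<close>, whose mean factorizes
  under independence.
\<close>

definition gap :: "real \<Rightarrow> real \<Rightarrow> real" where
  "gap s t = s * bin_entropy t + t * bin_entropy s - bin_entropy (s * t)"

text \<open>
  In the gap all terms \<open>st ln s\<close> and \<open>st ln t\<close> cancel; what is left is a combination of
  \<open>u + (1 - u) ln (1 - u)\<close> at \<open>u = s\<close>, \<open>t\<close> and \<open>st\<close>, and the power series of that function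
  recombines into products because its coefficients sum to \<open>1\<close>.
\<close>

lemma gap_sums:
  assumes "s \<in> {0..1}" "t \<in> {0..1}"
  shows "(\<lambda>k. (s - s ^ (k + 2)) * (t - t ^ (k + 2)) / ((k + 2) * (k + 1))) sums gap s t"
proof -
  consider "s = 1" | "t = 1" | "s = 0" | "t = 0" | "0 < s" "s < 1" "0 < t" "t < 1"
    using assms by force
  then show ?thesis
  proof cases
    case 5
    have "s * t < 1 * 1" using 5 by (intro mult_strict_mono) auto
    then have "s * t < 1" by simp
    have "(\<lambda>k. 1 / real (Suc k) - 1 / real (Suc (Suc k))) sums (1 / real (Suc 0) - 0)"
      by (intro telescope_sums' LIMSEQ_inverse_real_of_nat[unfolded inverse_eq_divide])
    also have "(\<lambda>k. 1 / real (Suc k) - 1 / real (Suc (Suc k))) = (\<lambda>k. 1 / real ((k + 2) * (k + 1)))"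
      using unit_fraction_diff by (simp add: fun_eq_iff)
    finally have c: "(\<lambda>k. 1 / real ((k + 2) * (k + 1))) sums 1" by simp
    have "(\<lambda>k. s * t * (1 / real ((k + 2) * (k + 1)))
             - s * (t ^ (k + 2) / ((k + 2) * (k + 1))) - t * (s ^ (k + 2) / ((k + 2) * (k + 1)))
             + (s * t) ^ (k + 2) / ((k + 2) * (k + 1)))
          sums (s * t * 1 - s * (t + (1 - t) * ln (1 - t)) - t * (s + (1 - s) * ln (1 - s))
             + (s * t + (1 - s * t) * ln (1 - s * t)))"
      using 5 \<open>s * t < 1\<close>
      by (intro sums_add sums_diff sums_mult c one_minus_ln_sums) (auto simp: abs_mult)
    also have "(\<lambda>k. s * t * (1 / real ((k + 2) * (k + 1)))
             - s * (t ^ (k + 2) / ((k + 2) * (k + 1))) - t * (s ^ (k + 2) / ((k + 2) * (k + 1)))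
             + (s * t) ^ (k + 2) / ((k + 2) * (k + 1)))
         = (\<lambda>k. (s - s ^ (k + 2)) * (t - t ^ (k + 2)) / ((k + 2) * (k + 1)))"
      by (intro ext) (simp add: diff_divide_distrib add_divide_distrib ring_distribs power_mult_distrib del: of_nat_mult of_nat_add power_Suc)
    also have "s * t * 1 - s * (t + (1 - t) * ln (1 - t)) - t * (s + (1 - s) * ln (1 - s))
             + (s * t + (1 - s * t) * ln (1 - s * t)) = gap s t"
      using 5 by (simp add: gap_def bin_entropy_def ln_mult) (simp add: algebra_simps)
    finally show ?thesis .
  qed (simp_all add: gap_def bin_entropy_def)
qed

text \<open>
  The gap is positive semidefinite by \<open>gap_sums\<close>, so its quadratic form at \<open>(1, - x)\<close> is nonnegative
  for every \<open>x\<close>; the best \<open>x\<close> gives the inequality.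
\<close>

lemma gap_Cauchy_Schwarz:
  assumes "s \<in> {0..1}" "t \<in> {0..1}"
  shows "(gap s t)\<^sup>2 \<le> gap s s * gap t t"
proof (cases "t = 0 \<or> t = 1")
  case True
  then show ?thesis using assms by (auto simp: gap_def bin_entropy_def)
next
  case False
  have nonneg: "0 \<le> gap s s - 2 * x * gap s t + x\<^sup>2 * gap t t" for x
  proof (rule sums_le[OF _ sums_zero])
    show "(\<lambda>k. (s - s ^ (k + 2)) * (s - s ^ (k + 2)) / ((k + 2) * (k + 1))
        - 2 * x * ((s - s ^ (k + 2)) * (t - t ^ (k + 2)) / ((k + 2) * (k + 1)))
        + x\<^sup>2 * ((t - t ^ (k + 2)) * (t - t ^ (k + 2)) / ((k + 2) * (k + 1))))
        sums (gap s s - 2 * x * gap s t + x\<^sup>2 * gap t t)"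
      by (intro sums_add sums_diff sums_mult gap_sums assms)
    fix k :: nat
    have square: "a * a / d - 2 * x * (a * b / d) + x\<^sup>2 * (b * b / d) = (a - x * b)\<^sup>2 / d" for a b d :: real
      by (simp add: power2_eq_square algebra_simps add_divide_distrib diff_divide_distrib)
    have "(s - s ^ (k + 2)) * (s - s ^ (k + 2)) / ((k + 2) * (k + 1))
        - 2 * x * ((s - s ^ (k + 2)) * (t - t ^ (k + 2)) / ((k + 2) * (k + 1)))
        + x\<^sup>2 * ((t - t ^ (k + 2)) * (t - t ^ (k + 2)) / ((k + 2) * (k + 1)))
        = ((s - s ^ (k + 2)) - x * (t - t ^ (k + 2)))\<^sup>2 / ((k + 2) * (k + 1))"
      by (rule square)
    then show "0 \<le> (s - s ^ (k + 2)) * (s - s ^ (k + 2)) / ((k + 2) * (k + 1))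
        - 2 * x * ((s - s ^ (k + 2)) * (t - t ^ (k + 2)) / ((k + 2) * (k + 1)))
        + x\<^sup>2 * ((t - t ^ (k + 2)) * (t - t ^ (k + 2)) / ((k + 2) * (k + 1)))"
      by simp
  qed
  have "0 < gap t t"
  proof -
    have t: "0 < t" "t < 1" using False assms by auto
    have "(\<Sum>k<1. (t - t ^ (k + 2)) * (t - t ^ (k + 2)) / ((k + 2) * (k + 1))) \<le> gap t t"
      using gap_sums[OF assms(2) assms(2)]
      by (intro sum_le_suminf[THEN order_trans]) (auto simp: sums_iff)
    moreover have "0 < t - t\<^sup>2" using t by (simp add: power2_eq_square)
    ultimately show ?thesis by (simp add: zero_less_mult_iff power2_eq_square)
       (smt (verit) mult_pos_pos)
  qed
  then have "0 \<le> gap t t * (gap s s - 2 * (gap s t / gap t t) * gap s t + (gap s t / gap t t)\<^sup>2 * gap t t)"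
    by (intro mult_nonneg_nonneg nonneg) simp
  also have "\<dots> = gap s s * gap t t - (gap s t)\<^sup>2"
    using \<open>0 < gap t t\<close> by (simp add: field_simps power2_eq_square)
  finally show ?thesis by simp
qed

section \<open>Properties of the binary entropy\<close>

lemma bin_entropy_pos: "0 < z \<Longrightarrow> z < 1 \<Longrightarrow> 0 < bin_entropy z"
proof -
  assume z: "0 < z" "z < 1"
  have "z * ln z < 0" "(1 - z) * ln (1 - z) < 0" using z by (simp_all add: mult_pos_neg)
  then show ?thesis by (simp add: bin_entropy_def)
qed

lemma bin_entropy_nonneg: "0 \<le> z \<Longrightarrow> z \<le> 1 \<Longrightarrow> 0 \<le> bin_entropy z"
  using bin_entropy_pos[of z] by (cases "z = 0 \<or> z = 1") (auto simp: bin_entropy_def)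

lemma bin_entropy_deriv:
  assumes "0 < z" "z < 1"
  shows "(bin_entropy has_real_derivative (ln (1 - z) - ln z)) (at z)"
proof -
  have "((\<lambda>t. - t * ln t - (1 - t) * ln (1 - t)) has_real_derivative
      (- 1 * ln z + - z * (1 / z)) - (- 1 * ln (1 - z) + (1 - z) * (1 / (1 - z) * - 1))) (at z)"
    using assms by (auto intro!: derivative_eq_intros)
  then show ?thesis using assms by (simp add: bin_entropy_def[abs_def])
qed

lemma bin_entropy_scale_le:
  assumes "1 \<le> k" "0 \<le> z" "k * z \<le> 1"
  shows "bin_entropy (k * z) \<le> k * bin_entropy z"
proof (cases "z = 0 \<or> k * z = 1")
  case True
  moreover have "0 \<le> bin_entropy z" "0 \<le> k" using assms
    by (auto intro!: bin_entropy_nonneg) (smt (verit) mult_le_cancel_right1)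
  ultimately show ?thesis by (auto simp: bin_entropy_def)
next
  case False
  have z: "0 < z" "z < 1" "k * z < 1" using False assms
    by (auto) (smt (verit) mult_le_cancel_right1)
  have "ln ((1 - z) / (1 - k * z)) \<le> (1 - z) / (1 - k * z) - 1"
    using z by (intro ln_le_minus_one) auto
  then have "(1 - k * z) * ln ((1 - z) / (1 - k * z)) \<le> (1 - k * z) * ((1 - z) / (1 - k * z) - 1)"
    using z by (intro mult_left_mono) auto
  also have "\<dots> = (1 - z) - (1 - k * z)" unfolding right_diff_distrib using z by simp
  also have "\<dots> = (k - 1) * z" by (simp add: algebra_simps)
  also have "\<dots> \<le> (k - 1) * - ln (1 - z)"
    using ln_le_minus_one[of "1 - z"] z assms by (intro mult_left_mono) auto
  finally have "(1 - k * z) * ln ((1 - z) / (1 - k * z)) \<le> (k - 1) * - ln (1 - z)" .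
  moreover have "ln ((1 - z) / (1 - k * z)) = ln (1 - z) - ln (1 - k * z)" using z by (simp add: ln_div)
  moreover have "0 \<le> k * z * ln k" using assms by simp
  moreover have "ln (k * z) = ln k + ln z" using assms z by (simp add: ln_mult)
  ultimately show ?thesis by (simp add: bin_entropy_def algebra_simps)
qed

text \<open>
  Equivalently, \<open>z h'(z) / h(z)\<close> is decreasing. With \<open>p = - ln z\<close> and \<open>r = - ln (1 - z)\<close> its derivative
  has the sign of \<open>p (r - z / (1 - z)) - r\<^sup>2 - r\<close>, and \<open>r \<le> z / (1 - z)\<close>.
\<close>

lemma bin_entropy_log_concave:
  assumes "0 < a" "a < 1" "0 < b" "b < 1"
  shows "bin_entropy a * bin_entropy b \<le> (bin_entropy (sqrt (a * b)))\<^sup>2"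
proof -
  define f where "f = (\<lambda>u. ln (bin_entropy (exp u)))"
  define h' where "h' = (\<lambda>z::real. ln (1 - z) - ln z)"
  have "concave_on {..<0} f"
  proof (rule f''_le0_imp_concave)
    fix u :: real assume "u \<in> {..<0}"
    then have u: "0 < exp u" "exp u < 1" by auto
    define z where "z = exp u"
    define H where "H = bin_entropy z"
    have z: "0 < z" "z < 1" and H: "0 < H" using u bin_entropy_pos by (auto simp: z_def H_def)
    note [derivative_intros] = DERIV_chain2[OF bin_entropy_deriv]
    show "(f has_real_derivative exp u * h' (exp u) / bin_entropy (exp u)) (at u)"
      unfolding f_def h'_def using u bin_entropy_pos[OF u]
      by (auto intro!: derivative_eq_intros simp: field_simps)
    show "((\<lambda>u. exp u * h' (exp u) / bin_entropy (exp u)) has_real_derivative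
        ((z * h' z - z / (1 - z)) * H - z * (h' z * (z * h' z))) / H\<^sup>2) (at u)"
      unfolding h'_def H_def z_def using u bin_entropy_pos[OF u]
      by (auto intro!: derivative_eq_intros simp: power2_eq_square field_simps)
    define p r where "p = - ln z" and "r = - ln (1 - z)"
    have pr: "0 < p" "0 < r" using z by (auto simp: p_def r_def)
    have "ln (1 / (1 - z)) \<le> 1 / (1 - z) - 1" using z by (intro ln_le_minus_one) auto
    moreover have "1 / (1 - z) - 1 = z / (1 - z)" using z by (simp add: field_simps)
    ultimately have "r \<le> z / (1 - z)" using z by (simp add: r_def ln_div)
    then have "p * (r - z / (1 - z)) \<le> 0" using pr by (simp add: mult_le_0_iff)
    moreover have "0 \<le> r\<^sup>2 + r" using pr by simp
    ultimately have *: "p * (r - z / (1 - z)) - r\<^sup>2 - r \<le> 0" by linarith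
    have Hpr: "H = z * p + (1 - z) * r" and hpr: "h' z = p - r"
      by (simp_all add: H_def bin_entropy_def p_def r_def h'_def)
    have "(z * h' z - z / (1 - z)) * H - z * (h' z * (z * h' z)) = z * (p * (r - z / (1 - z)) - r\<^sup>2 - r)"
      unfolding Hpr hpr using z by (simp add: field_simps power2_eq_square)
    then show "((z * h' z - z / (1 - z)) * H - z * (h' z * (z * h' z))) / H\<^sup>2 \<le> 0"
      using * z by (simp add: divide_nonpos_nonneg mult_nonneg_nonpos)
  qed simp
  then have "(f (ln a) + f (ln b)) / 2 \<le> f ((1 - 1/2) *\<^sub>R ln a + (1/2) *\<^sub>R ln b)"
    using concave_onD[of "{..<0}" f "1/2" "ln a" "ln b"] assms by simp
  also have "(1 - 1/2) *\<^sub>R ln a + (1/2) *\<^sub>R ln b = ln (sqrt (a * b))"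
    using assms by (simp add: ln_sqrt ln_mult)
  finally have "ln (bin_entropy a) + ln (bin_entropy b) \<le> 2 * ln (bin_entropy (sqrt (a * b)))"
    using assms by (simp add: f_def)
  moreover have "a * b < 1 * 1" using assms by (intro mult_strict_mono) auto
  then have ab: "0 < sqrt (a * b)" "sqrt (a * b) < 1" using assms by auto
  note pos = bin_entropy_pos[OF assms(1,2)] bin_entropy_pos[OF assms(3,4)] bin_entropy_pos[OF ab]
  ultimately have "ln (bin_entropy a * bin_entropy b) \<le> ln ((bin_entropy (sqrt (a * b)))\<^sup>2)"
    using pos by (simp add: ln_mult ln_realpow)
  then show ?thesis using pos by (simp add: ln_le_cancel_iff)
qed

section \<open>Polynomial bounds for the entropy\<close>

text \<open>
  Twice the distance of the entropy at \<open>(1 + z) / 2\<close> from its maximum \<open>ln 2\<close>. The diagonal of the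
  gap is a multiple of the same function (\<open>gap_diagonal\<close>), so that one family of polynomial bounds
  serves both sides of the diagonal inequalities.
\<close>

definition deficit :: "real \<Rightarrow> real" where
  "deficit z = (1 + z) * ln (1 + z) + (1 - z) * ln (1 - z)"

lemma bin_entropy_deficit:
  assumes "0 \<le> y" "y \<le> 1"
  shows "bin_entropy y = ln 2 - deficit (1 - 2 * y) / 2"
proof (cases "y = 0 \<or> y = 1")
  case False
  have "ln (2 - 2 * y) = ln 2 + ln (1 - y)" "ln (2 * y) = ln 2 + ln y"
    using False assms ln_mult[of 2 "1 - y"] by (auto simp: ln_mult)
  moreover have "deficit (1 - 2 * y) = (2 - 2 * y) * ln (2 - 2 * y) + 2 * y * ln (2 * y)"
    by (simp add: deficit_def)
  ultimately show ?thesis by (simp add: bin_entropy_def field_simps)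
qed (auto simp: bin_entropy_def deficit_def)

lemma gap_diagonal:
  assumes "0 \<le> t" "t \<le> 1"
  shows "gap t t = (1 - t) * deficit t"
proof (cases "t = 0 \<or> t = 1")
  case False
  have "1 - t * t = (1 + t) * (1 - t)" by (simp add: algebra_simps)
  then have "ln (1 - t * t) = ln (1 + t) + ln (1 - t)" "ln (t * t) = 2 * ln t"
    using False assms by (simp_all add: ln_mult)
  then show ?thesis by (simp add: gap_def bin_entropy_def deficit_def algebra_simps)
qed (auto simp: gap_def bin_entropy_def deficit_def)

lemma deficit_sums:
  assumes "\<bar>z\<bar> \<le> 1"
  shows "(\<lambda>k. z ^ (2 * k + 2) / ((k + 1) * (2 * k + 1))) sums deficit z"
proof (cases "\<bar>z\<bar> = 1")
  case True
  have "(\<lambda>n. \<Sum>k\<in>{n * 2..<n * 2 + 2}. (- 1) ^ k / real (Suc k)) sums ln 2"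
    by (intro sums_group alternating_harmonic_series_sums) simp
  then have "(\<lambda>n. 2 * (\<Sum>k\<in>{n * 2..<n * 2 + 2}. (- 1) ^ k / real (Suc k))) sums (2 * ln 2)"
    by (rule sums_mult)
  moreover have "2 * (\<Sum>k\<in>{n * 2..<n * 2 + 2}. (- 1) ^ k / real (Suc k)) = z ^ (2 * n + 2) / ((n + 1) * (2 * n + 1))" for n
  proof -
    have "{n * 2..<n * 2 + 2} = {2 * n, Suc (2 * n)}" by auto
    moreover have "z = 1 \<or> z = - 1" using True by auto
    then have "z ^ (2 * n + 2) = 1" by auto
    moreover have "2 * (1 / real (2 * n + 1) - 1 / real (2 * n + 2)) = 1 / real ((n + 1) * (2 * n + 1))"
    proof -
      have "real ((2 * n + 2) * (2 * n + 1)) = 2 * real ((n + 1) * (2 * n + 1))"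
        by (simp add: algebra_simps)
      moreover have "2 * (1 / (2 * c)) = 1 / c" for c :: real by simp
      ultimately show ?thesis by (simp only: unit_fraction_diff)
    qed
    ultimately show ?thesis by (simp add: add.commute)
  qed
  moreover have "deficit z = 2 * ln 2" using True by (auto simp: deficit_def abs_if split: if_splits)
  ultimately show ?thesis by simp
next
  case False
  then have z: "\<bar>z\<bar> < 1" using assms by simp
  let ?f = "\<lambda>k. z ^ (k + 2) / ((k + 2) * (k + 1)) + (- z) ^ (k + 2) / ((k + 2) * (k + 1))"
  have "?f sums ((z + (1 - z) * ln (1 - z)) + (- z + (1 - - z) * ln (1 - - z)))"
    using z by (intro sums_add one_minus_ln_sums) auto
  then have "?f sums deficit z" by (simp add: deficit_def algebra_simps)
  then have "(\<lambda>n. \<Sum>k\<in>{n * 2..<n * 2 + 2}. ?f k) sums deficit z"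
    by (rule sums_group) simp
  moreover have "(\<Sum>k\<in>{n * 2..<n * 2 + 2}. ?f k) = z ^ (2 * n + 2) / ((n + 1) * (2 * n + 1))" for n
  proof -
    have "{n * 2..<n * 2 + 2} = {2 * n, Suc (2 * n)}" by auto
    moreover have "?f (Suc (2 * n)) = 0"
      by (simp add: power_minus_odd del: power_Suc)
    moreover have "?f (2 * n) = z ^ (2 * n + 2) / ((n + 1) * (2 * n + 1))"
    proof -
      have "(- z) ^ (2 * n + 2) = z ^ (2 * n + 2)" by simp
      moreover have "x / real ((2 * n + 2) * (2 * n + 1)) + x / real ((2 * n + 2) * (2 * n + 1))
         = x / real ((n + 1) * (2 * n + 1))" for x
        by (simp add: divide_simps)
      ultimately show ?thesis by metis
    qed
    ultimately show ?thesis by simp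
  qed
  ultimately show ?thesis by simp
qed

text \<open>
  The coefficients of the series are positive with sum \<open>2 ln 2\<close>. Replacing every power beyond
  \<open>z ^ (2 n + 2)\<close> by that power gives a polynomial bound which for \<open>U = ln 2\<close> is exact at \<open>z = 1\<close>, where the
  entropy vanishes and a plain truncation would be useless.
\<close>

lemma deficit_le:
  assumes "\<bar>z\<bar> \<le> 1" "ln 2 \<le> U"
  shows "deficit z \<le> 2 * U * z ^ (2 * n + 2)
     + (\<Sum>k<n. (z ^ (2 * k + 2) - z ^ (2 * n + 2)) / real ((k + 1) * (2 * k + 1)))"
proof -
  let ?b = "\<lambda>k. real ((k + 1) * (2 * k + 1))"
  have "(\<lambda>k. 1 ^ (2 * k + 2) / ?b k) sums deficit 1" by (intro deficit_sums) simp
  then have b: "(\<lambda>k. 1 / ?b k) sums (2 * ln 2)" by (simp add: deficit_def)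
  have "deficit z - (\<Sum>k<n. z ^ (2 * k + 2) / ?b k) \<le> z ^ (2 * n + 2) * (2 * ln 2 - (\<Sum>k<n. 1 / ?b k))"
  proof (rule sums_le)
    show "(\<lambda>k. z ^ (2 * (k + n) + 2) / ?b (k + n)) sums (deficit z - (\<Sum>k<n. z ^ (2 * k + 2) / ?b k))"
      using sums_split_initial_segment[OF deficit_sums[OF assms(1)], of n] by simp
    show "(\<lambda>k. z ^ (2 * n + 2) * (1 / ?b (k + n))) sums (z ^ (2 * n + 2) * (2 * ln 2 - (\<Sum>k<n. 1 / ?b k)))"
      using sums_mult[OF sums_split_initial_segment[OF b, of n]] by simp
    fix k
    have "z ^ (2 * (k + n) + 2) = z ^ (2 * n + 2) * (z\<^sup>2) ^ k"
      by (simp only: power_add[symmetric] power_mult[symmetric]) (simp add: algebra_simps)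
    also have "\<dots> \<le> z ^ (2 * n + 2) * 1"
    proof (intro mult_left_mono zero_le_even_power)
      show "(z\<^sup>2) ^ k \<le> 1" by (rule power_le_one) (simp_all add: abs_square_le_1 assms(1))
    qed simp
    finally show "z ^ (2 * (k + n) + 2) / ?b (k + n) \<le> z ^ (2 * n + 2) * (1 / ?b (k + n))"
      by (simp add: divide_right_mono del: of_nat_mult of_nat_add)
  qed
  moreover have "z ^ (2 * n + 2) * ln 2 \<le> z ^ (2 * n + 2) * U"
    using assms(2) by (intro mult_left_mono zero_le_even_power) auto
  moreover have "(\<Sum>k<n. (z ^ (2 * k + 2) - z ^ (2 * n + 2)) / ?b k)
     = (\<Sum>k<n. z ^ (2 * k + 2) / ?b k) - z ^ (2 * n + 2) * (\<Sum>k<n. 1 / ?b k)"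
    by (simp add: diff_divide_distrib sum_subtractf sum_distrib_left)
  ultimately show ?thesis by (simp add: algebra_simps)
qed

lemma bin_entropy_ge:
  assumes "0 \<le> y" "y \<le> 1" "L \<le> ln 2" and z: "z = 1 - 2 * y"
  shows "L * (1 - z ^ (2 * n + 2))
     - (\<Sum>k<n. (z ^ (2 * k + 2) - z ^ (2 * n + 2)) / real ((k + 1) * (2 * k + 1))) / 2 \<le> bin_entropy y"
proof -
  have z1: "\<bar>z\<bar> \<le> 1" using assms by auto
  have "z ^ (2 * n + 2) = (z\<^sup>2) ^ (n + 1)" by (simp only: power_mult[symmetric]) simp
  also have "\<dots> \<le> 1" by (rule power_le_one) (simp_all add: abs_square_le_1 z1)
  finally have "z ^ (2 * n + 2) \<le> 1" .
  then have "L * (1 - z ^ (2 * n + 2)) \<le> ln 2 * (1 - z ^ (2 * n + 2))"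
    using assms by (intro mult_right_mono) auto
  also have "\<dots> = ln 2 - ln 2 * z ^ (2 * n + 2)" by (simp only: right_diff_distrib mult_1_right)
  finally show ?thesis
    using deficit_le[OF z1 order_refl, of n] bin_entropy_deficit[OF assms(1,2), folded z]
    unfolding mult.assoc by linarith
qed

section \<open>Lower bounds for polynomials on intervals\<close>

text \<open>
  A lower bound for a polynomial on \<open>[0, w]\<close>: Horner's scheme, in which each partial value, being
  multiplied by an unknown number between \<open>0\<close> and \<open>w\<close>, contributes at least \<open>min 0 (w * r)\<close>.
\<close>

definition poly_floor :: "real \<Rightarrow> real poly \<Rightarrow> real" where
  "poly_floor w p = fold_coeffs (\<lambda>c r. c + min 0 (w * r)) p 0"

lemma poly_floor_0 [simp]: "poly_floor w 0 = 0"
  by (simp add: poly_floor_def)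

lemma poly_floor_pCons [simp]: "poly_floor w (pCons c p) = c + min 0 (w * poly_floor w p)"
  by (cases "c = 0 \<and> p = 0") (auto simp: poly_floor_def)

lemma poly_floor_le:
  assumes "0 \<le> d" "d \<le> w"
  shows "poly_floor w p \<le> poly p d"
proof (induction p)
  case (pCons c p)
  have "min 0 (w * poly_floor w p) \<le> d * poly_floor w p"
  proof (cases "poly_floor w p \<ge> 0")
    case False
    then have "w * poly_floor w p \<le> d * poly_floor w p"
      using assms by (intro mult_right_mono_neg) auto
    then show ?thesis by simp
  qed (use assms in auto)
  also have "\<dots> \<le> d * poly p d" using pCons assms by (intro mult_left_mono) auto
  finally show ?case by simp
qed simp

text \<open>
  The form in which the bound is used: \<open>P\<close> is the expansion of \<open>f\<close> at \<open>a\<close>, to the right for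
  \<open>\<sigma> = 1\<close> and to the left for \<open>\<sigma> = - 1\<close>.
\<close>

lemma poly_floor_certificate:
  assumes "\<And>d. poly P d = f (a + \<sigma> * d)" "0 \<le> poly_floor w P" "0 \<le> d" "d \<le> w"
  shows "0 \<le> f (a + \<sigma> * d :: real)"
  using assms(1)[of d] assms(2) poly_floor_le[OF assms(3,4), of P] by linarith

section \<open>The diagonal inequalities\<close>

text \<open>
  \<open>1 - 2 p\<close> for the constant \<open>p\<close> of the theorem.
\<close>

definition gain :: real where "gain = 468459 / 2000000"

text \<open>
  Close to \<open>1 / (2 t\<^sup>2)\<close> at the maximum \<open>t = 0.6909\<dots>\<close> of \<open>gap t t\<close>. Its relative error must stay
  below about \<open>10 ^ (- 4)\<close>, since the loss is quadratic in it and only a few parts in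
  \<open>10 ^ 8\<close> are to spare.
\<close>

definition boost :: real where "boost = 20949 / 20000"

abbreviation (input) "ln2_lo \<equiv> 693147180 / 1000000000 :: real"
abbreviation (input) "ln2_hi \<equiv> 693147181 / 1000000000 :: real"

lemma ln2_bounds: "ln2_lo \<le> ln 2" "ln 2 \<le> ln2_hi"
  using ln_approx_bounds[of 2 9] by (simp_all add: eval_nat_numeral)

lemmas poly_eval = pcompose_pCons one_pCons poly_pcompose gain_def boost_def

text \<open>
  The bounds \<open>bin_entropy_ge\<close> and \<open>deficit_le\<close> as polynomials in the square of the variable, with
  \<open>L \<le> ln 2 \<le> U\<close>; the final digit counts the powers kept.
\<close>

abbreviation (input) entropy_poly2 :: "real \<Rightarrow> real poly" where
  "entropy_poly2 L \<equiv> [:L, - 1/2, 1/2 - L:]"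
abbreviation (input) entropy_poly4 :: "real \<Rightarrow> real poly" where
  "entropy_poly4 L \<equiv> [:L, - 1/2, - 1/12, - 1/30, 37/60 - L:]"
abbreviation (input) deficit_poly4 :: "real \<Rightarrow> real poly" where
  "deficit_poly4 U \<equiv> [:0, 1, 1/6, 1/15, 2 * U - 37/30:]"
abbreviation (input) deficit_poly5 :: "real \<Rightarrow> real poly" where
  "deficit_poly5 U \<equiv> [:0, 1, 1/6, 1/15, 1/28, 2 * U - 533/420:]"

lemma entropy_poly_bounds:
  assumes "0 \<le> y" "y \<le> 1" "L \<le> ln 2"
  shows "poly (entropy_poly2 L) ((1 - 2 * y)\<^sup>2) \<le> bin_entropy y"
    and "poly (entropy_poly4 L) ((1 - 2 * y)\<^sup>2) \<le> bin_entropy y"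
proof -
  define z where "z = 1 - 2 * y"
  have "L * (1 - z ^ (2 * 1 + 2)) - (\<Sum>k<1. (z ^ (2 * k + 2) - z ^ (2 * 1 + 2)) / real ((k + 1) * (2 * k + 1))) / 2
      = poly (entropy_poly2 L) (z\<^sup>2)"
    by (simp add: eval_nat_numeral field_simps)
  then show "poly (entropy_poly2 L) ((1 - 2 * y)\<^sup>2) \<le> bin_entropy y"
    using bin_entropy_ge[OF assms z_def, of 1] by (simp only: z_def)
  have "L * (1 - z ^ (2 * 3 + 2)) - (\<Sum>k<3. (z ^ (2 * k + 2) - z ^ (2 * 3 + 2)) / real ((k + 1) * (2 * k + 1))) / 2
      = poly (entropy_poly4 L) (z\<^sup>2)"
    by (simp add: eval_nat_numeral field_simps)
  then show "poly (entropy_poly4 L) ((1 - 2 * y)\<^sup>2) \<le> bin_entropy y"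
    using bin_entropy_ge[OF assms z_def, of 3] by (simp only: z_def)
qed

lemma deficit_poly_bounds:
  assumes "\<bar>z\<bar> \<le> 1" "ln 2 \<le> U"
  shows "deficit z \<le> poly (deficit_poly4 U) (z\<^sup>2)" and "deficit z \<le> poly (deficit_poly5 U) (z\<^sup>2)"
proof -
  have "2 * U * z ^ (2 * 3 + 2) + (\<Sum>k<3. (z ^ (2 * k + 2) - z ^ (2 * 3 + 2)) / real ((k + 1) * (2 * k + 1)))
      = poly (deficit_poly4 U) (z\<^sup>2)"
    by (simp add: eval_nat_numeral field_simps)
  then show "deficit z \<le> poly (deficit_poly4 U) (z\<^sup>2)"
    using deficit_le[OF assms, of 3] by (simp only:)
  have "2 * U * z ^ (2 * 4 + 2) + (\<Sum>k<4. (z ^ (2 * k + 2) - z ^ (2 * 4 + 2)) / real ((k + 1) * (2 * k + 1)))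
      = poly (deficit_poly5 U) (z\<^sup>2)"
    by (simp add: eval_nat_numeral field_simps)
  then show "deficit z \<le> poly (deficit_poly5 U) (z\<^sup>2)"
    using deficit_le[OF assms, of 4] by (simp only:)
qed

lemma bin_entropy_mono:
  assumes "0 \<le> x" "x \<le> y" "y \<le> 1/2"
  shows "bin_entropy x \<le> bin_entropy y"
proof (cases "x = 0")
  case True
  then show ?thesis using bin_entropy_nonneg[of y] assms by (simp add: bin_entropy_def)
next
  case False
  show ?thesis
  proof (rule DERIV_nonneg_imp_nondecreasing[OF assms(2)])
    fix z assume "x \<le> z" "z \<le> y"
    then have "0 < z" "z < 1" "ln z \<le> ln (1 - z)" using assms False by auto
    then show "\<exists>D. DERIV bin_entropy z :> D \<and> 0 \<le> D" using bin_entropy_deriv[of z] by fastforce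
  qed
qed

lemma poly_affine: "poly [:a, \<sigma>:] d = a + \<sigma> * d"
  by (simp add: mult.commute)

text \<open>
  Away from the maximum short constants suffice. Four powers are needed in the entropy bound because
  at \<open>t = 0\<close> it vanishes to second order like the gap, with a coefficient that is too small if fewer
  powers are kept.
\<close>

lemma diagonal_low:
  assumes "0 \<le> t" "t \<le> 55/100"
  shows "gap t t \<le> gain * bin_entropy (boost * t\<^sup>2)"
proof -
  \<comment> \<open>\<open>117/500\<close> and \<open>26/25\<close> are \<open>gain\<close> and \<open>boost\<close>, rounded down\<close>
  define f where "f x = 117/500 * poly (entropy_poly4 (69/100)) ((1 - 2 * (26/25 * x\<^sup>2))\<^sup>2)
      - (1 - x) * poly (deficit_poly4 (7/10)) (x\<^sup>2)" for x
  define P :: "real \<Rightarrow> real poly" where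
    "P a = smult (117/500) (pcompose (entropy_poly4 (69/100))
              ((1 - smult (2 * (26/25)) ([:a, 1:] * [:a, 1:])) * (1 - smult (2 * (26/25)) ([:a, 1:] * [:a, 1:]))))
          - (1 - [:a, 1:]) * pcompose (deficit_poly4 (7/10)) ([:a, 1:] * [:a, 1:])" for a
  have P: "poly (P a) d = f (a + 1 * d)" for a d
    by (simp only: P_def f_def poly_mult poly_diff poly_smult poly_pcompose poly_1 poly_affine
          power2_eq_square mult.assoc)
  have "0 \<le> poly_floor (1/5) (P 0)" "0 \<le> poly_floor (1/5) (P (1/5))"
    "0 \<le> poly_floor (1/10) (P (2/5))" "0 \<le> poly_floor (1/20) (P (1/2))"
    by (simp_all add: P_def poly_eval)
  note cert = this[THEN poly_floor_certificate[OF P]]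
  have "0 \<le> f t"
    using assms cert(1)[of t] cert(2)[of "t - 1/5"] cert(3)[of "t - 2/5"] cert(4)[of "t - 1/2"]
    by (cases "t \<le> 1/5"; cases "t \<le> 2/5"; cases "t \<le> 1/2") simp_all
  have t2: "boost * t\<^sup>2 \<le> 1/2" "26/25 * t\<^sup>2 \<le> boost * t\<^sup>2"
    using power_mono[OF assms(2) assms(1), of 2] by (simp_all add: boost_def power2_eq_square)
  have "gap t t = (1 - t) * deficit t" using assms by (simp add: gap_diagonal)
  also have "\<dots> \<le> (1 - t) * poly (deficit_poly4 (7/10)) (t\<^sup>2)"
    using assms ln2_bounds by (intro mult_left_mono deficit_poly_bounds) auto
  also have "\<dots> \<le> 117/500 * poly (entropy_poly4 (69/100)) ((1 - 2 * (26/25 * t\<^sup>2))\<^sup>2)"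
    using \<open>0 \<le> f t\<close> by (simp only: f_def)
  also have "\<dots> \<le> 117/500 * bin_entropy (26/25 * t\<^sup>2)"
    using t2 ln2_bounds by (intro mult_left_mono entropy_poly_bounds) simp_all
  also have "\<dots> \<le> 117/500 * bin_entropy (boost * t\<^sup>2)"
    using t2 by (intro mult_left_mono bin_entropy_mono) simp_all
  also have "\<dots> \<le> gain * bin_entropy (boost * t\<^sup>2)"
    using t2 by (intro mult_right_mono bin_entropy_nonneg) (simp_all add: gain_def boost_def)
  finally show ?thesis .
qed

text \<open>
  Here the entropy is taken at \<open>t\<^sup>2\<close> and the factor \<open>boost\<close> is on the other side; the
  relative slack is about three percent at \<open>t = 17/20\<close> and grows towards \<open>1\<close>.
\<close>

lemma boundary_high:
  assumes "85/100 \<le> t" "t \<le> 1"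
  shows "boost * gap t t \<le> gain * bin_entropy (t\<^sup>2)"
proof -
  \<comment> \<open>\<open>117/500\<close> is \<open>gain\<close> rounded down, \<open>21/20\<close> is \<open>boost\<close> rounded up\<close>
  define f where "f x = 117/500 * poly (entropy_poly2 (693/1000)) ((1 - 2 * (1 - x)\<^sup>2)\<^sup>2)
      - 21/20 * (x * poly (deficit_poly5 (694/1000)) ((1 - x)\<^sup>2))" for x
  define P :: "real \<Rightarrow> real poly" where
    "P a = smult (117/500) (pcompose (entropy_poly2 (693/1000))
              ((1 - smult 2 ((1 - [:a, 1:]) * (1 - [:a, 1:]))) * (1 - smult 2 ((1 - [:a, 1:]) * (1 - [:a, 1:])))))
          - smult (21/20) ([:a, 1:] * pcompose (deficit_poly5 (694/1000)) ((1 - [:a, 1:]) * (1 - [:a, 1:])))" for a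
  have P: "poly (P a) d = f (a + 1 * d)" for a d
    by (simp only: P_def f_def poly_mult poly_diff poly_smult poly_pcompose poly_1 poly_affine
          power2_eq_square mult.assoc)
  have "0 \<le> poly_floor (1/20) (P 0)" "0 \<le> poly_floor (1/20) (P (1/20))" "0 \<le> poly_floor (1/20) (P (1/10))"
    by (simp_all add: P_def poly_eval)
  note cert = this[THEN poly_floor_certificate[OF P]]
  have "0 \<le> f (1 - t)"
    using assms cert(1)[of "1 - t"] cert(2)[of "1 - t - 1/20"] cert(3)[of "1 - t - 1/10"]
    by (cases "1 - t \<le> 1/20"; cases "1 - t \<le> 1/10") simp_all
  then have f: "21/20 * ((1 - t) * poly (deficit_poly5 (694/1000)) (t\<^sup>2))
      \<le> 117/500 * poly (entropy_poly2 (693/1000)) ((1 - 2 * t\<^sup>2)\<^sup>2)"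
    unfolding f_def by simp
  have "boost * gap t t = boost * ((1 - t) * deficit t)" using assms by (simp add: gap_diagonal)
  also have "\<dots> \<le> boost * ((1 - t) * poly (deficit_poly5 (694/1000)) (t\<^sup>2))"
    using assms ln2_bounds by (intro mult_left_mono deficit_poly_bounds) (auto simp: boost_def)
  also have "\<dots> \<le> 21/20 * ((1 - t) * poly (deficit_poly5 (694/1000)) (t\<^sup>2))"
    using assms by (intro mult_right_mono mult_nonneg_nonneg) (auto simp: boost_def)
  also note f
  also have "117/500 * poly (entropy_poly2 (693/1000)) ((1 - 2 * t\<^sup>2)\<^sup>2) \<le> 117/500 * bin_entropy (t\<^sup>2)"
    using assms ln2_bounds by (intro mult_left_mono entropy_poly_bounds) (simp_all add: power_le_one)
  also have "\<dots> \<le> gain * bin_entropy (t\<^sup>2)"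
    using assms by (intro mult_right_mono bin_entropy_nonneg) (simp_all add: gain_def power_le_one)
  finally show ?thesis .
qed

text \<open>
  The point of near equality, rounded.
\<close>

abbreviation (input) "peak \<equiv> 6909 / 10000 :: real"

lemma ln_artanh_bounds:
  fixes x y :: real
  assumes "1 < x" "(x - 1) / (x + 1) = y"
  shows "(\<Sum>k<n. 2 * y * (y\<^sup>2) ^ k / (2 * real k + 1)) \<le> ln x"
    and "ln x \<le> (\<Sum>k<n. 2 * y * (y\<^sup>2) ^ k / (2 * real k + 1)) + 2 * y * (y\<^sup>2) ^ n / ((1 - y\<^sup>2) * (2 * real n + 1))"
proof -
  have "2 * y ^ (2 * k + 1) / real (2 * k + 1) = 2 * y * (y\<^sup>2) ^ k / (2 * real k + 1)" for k
    by (simp add: power_mult add.commute)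
  moreover have "2 * (y ^ (2 * n + 1) / (1 - y\<^sup>2) / real (2 * n + 1)) = 2 * y * (y\<^sup>2) ^ n / ((1 - y\<^sup>2) * (2 * real n + 1))"
    by (simp add: power_mult add.commute)
  ultimately show "(\<Sum>k<n. 2 * y * (y\<^sup>2) ^ k / (2 * real k + 1)) \<le> ln x"
    "ln x \<le> (\<Sum>k<n. 2 * y * (y\<^sup>2) ^ k / (2 * real k + 1)) + 2 * y * (y\<^sup>2) ^ n / ((1 - y\<^sup>2) * (2 * real n + 1))"
    using ln_approx_bounds[OF assms(1), of n] unfolding assms(2) by simp_all
qed

lemma ln_one_plus_peak:
  "525260931 / 1000000000 \<le> ln (16909 / 10000 :: real)"
  "ln (16909 / 10000 :: real) \<le> 525260932 / 1000000000"
proof -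
  let ?y = "6909 / 26909 :: real"
  note b = ln_artanh_bounds[of "16909 / 10000" ?y 7]
  have "525260931 / 1000000000 \<le> (\<Sum>k<7. 2 * ?y * (?y\<^sup>2) ^ k / (2 * real k + 1))"
    by (simp add: lessThan_nat_numeral power_divide)
  also have "\<dots> \<le> ln (16909 / 10000)" by (rule b) simp_all
  finally show "525260931 / 1000000000 \<le> ln (16909 / 10000 :: real)" .
  have "ln (16909 / 10000) \<le> (\<Sum>k<7. 2 * ?y * (?y\<^sup>2) ^ k / (2 * real k + 1))
      + 2 * ?y * (?y\<^sup>2) ^ 7 / ((1 - ?y\<^sup>2) * (2 * real 7 + 1))"
    using b(2) by simp
  also have "\<dots> \<le> 525260932 / 1000000000"
    by (simp add: lessThan_nat_numeral power_divide)
  finally show "ln (16909 / 10000 :: real) \<le> 525260932 / 1000000000" .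
qed

text \<open>
  The series converges slowly at \<open>3091 / 10000\<close>, but fast at four times that number.
\<close>

lemma ln_one_minus_peak:
  "2122039 / 10000000 - 2 * ln 2 \<le> ln (3091 / 10000 :: real)"
  "ln (3091 / 10000 :: real) \<le> 2122039314 / 10000000000 - 2 * ln 2"
proof -
  let ?y = "591 / 5591 :: real"
  note b = ln_artanh_bounds[of "3091 / 2500" ?y 5]
  have "ln (4::real) = 2 * ln 2" using ln_realpow[of 2 2] by simp
  then have "ln (x / 4) = ln x - 2 * ln 2" if "0 < x" for x :: real using that by (simp add: ln_div)
  from this[of "3091 / 2500"] have *: "ln (3091 / 10000 :: real) = ln (3091 / 2500) - 2 * ln 2" by simp
  have "2122039 / 10000000 \<le> (\<Sum>k<5. 2 * ?y * (?y\<^sup>2) ^ k / (2 * real k + 1))"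
    by (simp add: lessThan_nat_numeral power_divide)
  also have "\<dots> \<le> ln (3091 / 2500)" by (rule b) simp_all
  finally show "2122039 / 10000000 - 2 * ln 2 \<le> ln (3091 / 10000 :: real)" unfolding * by linarith
  have "ln (3091 / 2500) \<le> (\<Sum>k<5. 2 * ?y * (?y\<^sup>2) ^ k / (2 * real k + 1))
      + 2 * ?y * (?y\<^sup>2) ^ 5 / ((1 - ?y\<^sup>2) * (2 * real 5 + 1))"
    using b(2) by simp
  also have "\<dots> \<le> 2122039314 / 10000000000"
    by (simp add: lessThan_nat_numeral power_divide)
  finally show "ln (3091 / 10000 :: real) \<le> 2122039314 / 10000000000 - 2 * ln 2" unfolding * by linarith
qed

lemma deficit_at_peak:
  "deficit peak \<le> 525252359 / 1000000000"
  "1699351 / 1000000 \<le> ln (1 + peak) - ln (1 - peak)"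
  "ln (1 + peak) - ln (1 - peak) \<le> 1699352 / 1000000"
proof -
  have "1 + peak = 16909 / 10000" "1 - peak = 3091 / 10000" by simp_all
  then show "deficit peak \<le> 525252359 / 1000000000"
    "1699351 / 1000000 \<le> ln (1 + peak) - ln (1 - peak)"
    "ln (1 + peak) - ln (1 - peak) \<le> 1699352 / 1000000"
    using ln_one_plus_peak ln_one_minus_peak ln2_bounds unfolding deficit_def by simp_all
qed

lemma deficit_deriv:
  assumes "\<bar>x\<bar> < 1"
  shows "(deficit has_real_derivative ln (1 + x) - ln (1 - x)) (at x)"
    and "((\<lambda>x. ln (1 + x) - ln (1 - x)) has_real_derivative 1 / (1 + x) + 1 / (1 - x)) (at x)"
proof -
  have x: "0 < 1 + x" "0 < 1 - x" using assms by auto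
  have "((\<lambda>z. (1 + z) * ln (1 + z) + (1 - z) * ln (1 - z)) has_real_derivative
      (1 * ln (1 + x) + (1 + x) * (1 / (1 + x))) + (- 1 * ln (1 - x) + (1 - x) * (- 1 / (1 - x)))) (at x)"
    using x by (auto intro!: derivative_eq_intros)
  then show "(deficit has_real_derivative ln (1 + x) - ln (1 - x)) (at x)"
    using x by (simp add: deficit_def[abs_def])
  show "((\<lambda>x. ln (1 + x) - ln (1 - x)) has_real_derivative 1 / (1 + x) + 1 / (1 - x)) (at x)"
    using x by (auto intro!: derivative_eq_intros)
qed

text \<open>
  The second derivative of the deficit is the rational function \<open>2 / (1 - x\<^sup>2)\<close>, which lies below that
  of the right-hand side on the whole interval; value and slope agree at the peak. The coefficients
  of the higher powers are rounded up generously, since near the peak only value, slope and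
  curvature matter.
\<close>

lemma deficit_near_peak:
  assumes "55/100 \<le> t" "t \<le> 85/100"
  shows "deficit t \<le> deficit peak + (ln (1 + peak) - ln (1 - peak)) * (t - peak)
     + 1915/1000 * (t - peak)^2 + 17/10 * (t - peak)^3 + 25/4 * (t - peak)^4"
proof (cases "t = peak")
  case False
  \<comment> \<open>the difference of the two sides and its first two derivatives\<close>
  define D where "D m = (if m = 0 then \<lambda>t. deficit peak + (ln (1 + peak) - ln (1 - peak)) * (t - peak)
        + 1915/1000 * (t - peak)^2 + 17/10 * (t - peak)^3 + 25/4 * (t - peak)^4 - deficit t
      else if m = 1 then \<lambda>t. (ln (1 + peak) - ln (1 - peak))
        + 383/100 * (t - peak) + 51/10 * (t - peak)^2 + 25 * (t - peak)^3 - (ln (1 + t) - ln (1 - t))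
      else (\<lambda>t. 383/100 + 51/5 * (t - peak) + 75 * (t - peak)^2 - (1 / (1 + t) + 1 / (1 - t))))" for m :: nat
  have "\<exists>x. (if t < peak then t < x \<and> x < peak else peak < x \<and> x < t) \<and>
      D 0 t = (\<Sum>m<2. (D m peak / fact m) * (t - peak) ^ m) + (D 2 x / fact 2) * (t - peak)\<^sup>2"
  proof (rule Taylor[where a = "55/100" and b = "85/100"])
    show "\<forall>m x. m < 2 \<and> 55/100 \<le> x \<and> x \<le> 85/100 \<longrightarrow> (D m has_real_derivative D (Suc m) x) (at x)"
    proof (intro allI impI)
      fix m :: nat and x :: real
      assume "m < 2 \<and> 55/100 \<le> x \<and> x \<le> 85/100"
      then consider "m = 0" "0 < x" "x < 1" | "m = 1" "0 < x" "x < 1" by fastforce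
      then show "(D m has_real_derivative D (Suc m) x) (at x)"
      proof cases
        case 1
        show ?thesis unfolding D_def 1 using 1
          by (auto intro!: derivative_eq_intros deficit_deriv)
      next
        case 2
        show ?thesis unfolding D_def 2 using 2
          by (auto intro!: derivative_eq_intros)
      qed
    qed
  qed (use assms False in auto)
  then obtain x where "if t < peak then t < x \<and> x < peak else peak < x \<and> x < t"
    and eq: "D 0 t = (\<Sum>m<2. (D m peak / fact m) * (t - peak) ^ m) + (D 2 x / fact 2) * (t - peak)\<^sup>2"
    by blast
  then have x: "55/100 \<le> x" "x \<le> 85/100" using assms by (auto split: if_splits)
  define f where "f \<delta> = poly [:383/100, 51/5, 75:] \<delta> * (1 - (peak + \<delta>)\<^sup>2) - 2" for \<delta>
  define P where "P a \<sigma> = pcompose [:383/100, 51/5, 75:] [:a, \<sigma>:]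
      * (1 - [:peak + a, \<sigma>:] * [:peak + a, \<sigma>:]) - [:2:]" for a \<sigma>
  have two: "poly [:2:] d = 2" for d :: real by simp
  have P: "poly (P a \<sigma>) d = f (a + \<sigma> * d)" for a \<sigma> d
    by (simp only: P_def f_def poly_mult poly_diff poly_pcompose poly_1 poly_affine two
        power2_eq_square add.assoc)
  have "0 \<le> poly_floor (1591/10000) (P 0 1)"
    "0 \<le> poly_floor (40/1000) (P 0 (-1))" "0 \<le> poly_floor (1009/10000) (P (-40/1000) (-1))"
    by (simp_all add: P_def poly_eval)
  note cert = this[THEN poly_floor_certificate[OF P]]
  have "0 \<le> f (x - peak)"
    using x cert(1)[of "x - peak"] cert(2)[of "peak - x"] cert(3)[of "peak - x - 40/1000"]
    by (cases "peak \<le> x"; cases "peak - x \<le> 40/1000") simp_all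
  moreover have "D 2 x = f (x - peak) / (1 - x\<^sup>2)"
  proof -
    define q where "q = 383/100 + 51/5 * (x - peak) + 75 * (x - peak)^2"
    have "1 - x\<^sup>2 = (1 + x) * (1 - x)" by (simp add: power2_eq_square algebra_simps)
    moreover have "1 + x \<noteq> 0" "1 - x \<noteq> 0" using x by auto
    then have "2 / ((1 + x) * (1 - x)) = 1 / (1 + x) + 1 / (1 - x)" "(1 + x) * (1 - x) \<noteq> 0"
      by (simp_all add: add_frac_eq)
    ultimately have "2 / (1 - x\<^sup>2) = 1 / (1 + x) + 1 / (1 - x)" "1 - x\<^sup>2 \<noteq> 0"
      by simp_all
    moreover have "f (x - peak) = q * (1 - x\<^sup>2) - 2"
      by (simp add: f_def q_def power2_eq_square algebra_simps)
    ultimately show ?thesis by (simp add: D_def q_def diff_divide_distrib)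
  qed
  ultimately have "0 \<le> D 2 x" using x by (simp add: power_le_one)
  then have "0 \<le> D 0 t" unfolding eq by (simp add: D_def eval_nat_numeral)
  then show ?thesis by (simp add: D_def)
next
  case True
  then show ?thesis unfolding True by simp
qed

text \<open>
  After expansion at the peak the difference of the two sides is about
  \<open>1.3 * 10 ^ (- 8) + 0.126 \<delta>\<^sup>2\<close>, with a linear term of size \<open>10 ^ (- 5)\<close> that is harmless because of
  the quadratic one. The slope of the deficit is known to lie in an interval, whose upper end is the
  relevant one to the right of the peak and whose lower end to the left.
\<close>

lemma diagonal_peak:
  assumes "55/100 \<le> t" "t \<le> 85/100"
  shows "gap t t \<le> gain * bin_entropy (boost * t\<^sup>2)"
proof -
  define T where "T m = [:525252359 / 1000000000, m, 1915/1000, 17/10, 25/4:]" for m :: real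
  define f where "f m \<delta> = gain * poly (entropy_poly2 ln2_lo) ((1 - 2 * (boost * (peak + \<delta>)\<^sup>2))\<^sup>2)
      - (1 - (peak + \<delta>)) * poly (T m) \<delta>" for m \<delta>
  define P where
    "P m a \<sigma> = smult gain (pcompose (entropy_poly2 ln2_lo)
         ((1 - smult (2 * boost) ([:peak + a, \<sigma>:] * [:peak + a, \<sigma>:]))
        * (1 - smult (2 * boost) ([:peak + a, \<sigma>:] * [:peak + a, \<sigma>:]))))
      - (1 - [:peak + a, \<sigma>:]) * pcompose (T m) [:a, \<sigma>:]" for m a \<sigma>
  have P: "poly (P m a \<sigma>) d = f m (a + \<sigma> * d)" for m a \<sigma> d
    by (simp only: P_def f_def poly_mult poly_diff poly_smult poly_pcompose poly_1 poly_affine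
          power2_eq_square mult.assoc add.assoc)
  have "0 \<le> poly_floor (15/10000) (P (1699352 / 1000000) 0 1)"
    "0 \<le> poly_floor (1576/10000) (P (1699352 / 1000000) (15/10000) 1)"
    "0 \<le> poly_floor (1409/10000) (P (1699351 / 1000000) 0 (-1))"
    by (simp_all add: P_def T_def poly_eval)
  note cert = this[THEN poly_floor_certificate[OF P]]
  \<comment> \<open>the end of the slope interval that is the worse one on the side of \<open>t\<close>\<close>
  define m where "m = (if peak \<le> t then 1699352 / 1000000 else 1699351 / 1000000 :: real)"
  have "0 \<le> f m (t - peak)"
    using assms cert(1)[of "t - peak"] cert(2)[of "t - peak - 15/10000"] cert(3)[of "peak - t"]
    by (cases "peak \<le> t"; cases "t - peak \<le> 15/10000") (simp_all add: m_def)
  moreover have "boost * t\<^sup>2 \<le> 1"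
    using power_mono[OF assms(2), of 2] assms by (simp add: boost_def power2_eq_square)
  then have "gain * poly (entropy_poly2 ln2_lo) ((1 - 2 * (boost * t\<^sup>2))\<^sup>2) \<le> gain * bin_entropy (boost * t\<^sup>2)"
    using ln2_bounds by (intro mult_left_mono entropy_poly_bounds) (simp_all add: boost_def gain_def)
  moreover have "deficit t \<le> poly (T m) (t - peak)"
  proof -
    have "(ln (1 + peak) - ln (1 - peak)) * (t - peak) \<le> m * (t - peak)"
    proof (cases "peak \<le> t")
      case True
      then show ?thesis using deficit_at_peak(3) unfolding m_def by (intro mult_right_mono) auto
    next
      case False
      then show ?thesis using deficit_at_peak(2) unfolding m_def by (intro mult_right_mono_neg) auto
    qed
    moreover have "poly (T m) \<delta> = 525252359 / 1000000000 + m * \<delta> + 1915/1000 * \<delta>^2 + 17/10 * \<delta>^3 + 25/4 * \<delta>^4" for \<delta>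
      by (simp add: T_def eval_nat_numeral algebra_simps)
    ultimately show ?thesis
      using deficit_near_peak[OF assms] deficit_at_peak(1) by (simp only:)
  qed
  then have "(1 - t) * deficit t \<le> (1 - t) * poly (T m) (t - peak)"
    using assms by (intro mult_left_mono) auto
  moreover have "gap t t = (1 - t) * deficit t" using assms by (intro gap_diagonal) auto
  ultimately show ?thesis by (simp add: f_def)
qed

section \<open>The correlated coupling\<close>

lemma diagonal_main:
  assumes "0 \<le> t" "t \<le> 85/100"
  shows "gap t t \<le> gain * bin_entropy (boost * t\<^sup>2)"
  using diagonal_low[of t] diagonal_peak[of t] assms by (cases "t \<le> 55/100") auto

text \<open>
  The cut-off keeps \<open>boost * s * t\<close> below \<open>s\<close> and \<open>t\<close>; it lies where both diagonal inequalities, with the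
  boost inside the entropy and with the boost as a factor of the gap, have room.
\<close>

definition correlation :: "real \<Rightarrow> real" where
  "correlation s = (if s \<le> 85/100 then sqrt (boost - 1) * s else 0)"

lemma both_absent_correlation:
  "both_absent correlation s t = (if s \<le> 85/100 \<and> t \<le> 85/100 then boost * (s * t) else s * t)"
proof -
  have "sqrt (boost - 1) * s * (sqrt (boost - 1) * t) = (sqrt (boost - 1) * sqrt (boost - 1)) * (s * t)"
    by (simp only: mult_ac)
  also have "sqrt (boost - 1) * sqrt (boost - 1) = boost - 1" by (simp add: boost_def)
  finally show ?thesis by (auto simp: both_absent_def correlation_def algebra_simps)
qed

lemma admissible_independent: "admissible (\<lambda>_. 0)"
proof -
  have "s + t - 1 \<le> s * t" if "s \<le> 1" "t \<le> 1" for s t :: real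
    using mult_nonneg_nonneg[of "1 - s" "1 - t"] that by (simp add: algebra_simps)
  then show ?thesis
    by (auto simp: admissible_def both_absent_def mult_left_le mult_left_le_one_le)
qed

lemma admissible_correlation: "admissible correlation"
proof -
  have le: "boost * (s * t) \<le> s" if "0 \<le> s" "0 \<le> t" "t \<le> 85/100" for s t
  proof -
    \<comment> \<open>\<open>boost * 85/100 < 1\<close>\<close>
    have "s * (boost * t) \<le> s * 1" using that by (intro mult_left_mono) (auto simp: boost_def)
    then show ?thesis by (simp add: mult_ac)
  qed
  have ge: "s * t \<le> boost * (s * t)" if "0 \<le> s" "0 \<le> t" for s t
    using that by (simp add: boost_def mult_le_cancel_right1)
  show ?thesis
    unfolding admissible_def
  proof (intro ballI)
    fix s t :: real assume st: "s \<in> {0..1}" "t \<in> {0..1}"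
    have "max 0 (s + t - 1) \<le> s * t" "s * t \<le> min s t"
      using admissible_independent st by (auto simp: admissible_def both_absent_def)
    then show "max 0 (s + t - 1) \<le> both_absent correlation s t \<and> both_absent correlation s t \<le> min s t"
      using st ge[of s t] le[of s t] le[of t s] by (auto simp: both_absent_correlation mult.commute)
  qed
qed

lemma bin_entropy_geometric:
  assumes "0 < s" "0 < t" "0 < c" "c * s\<^sup>2 < 1" "c * t\<^sup>2 < 1"
  shows "bin_entropy (c * s\<^sup>2) * bin_entropy (c * t\<^sup>2) \<le> (bin_entropy (c * (s * t)))\<^sup>2"
proof -
  have "c * s\<^sup>2 * (c * t\<^sup>2) = (c * (s * t))\<^sup>2" by (simp add: power2_eq_square)
  then have "sqrt (c * s\<^sup>2 * (c * t\<^sup>2)) = c * (s * t)" using assms by simp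
  then show ?thesis using bin_entropy_log_concave[of "c * s\<^sup>2" "c * t\<^sup>2"] assms by simp
qed

text \<open>
  By Cauchy-Schwarz and log-concavity it is enough to bound \<open>gap s s * gap t t\<close> by the product of two
  diagonal values of \<open>e\<close>. If only one argument is below the cut-off, then the coupling is
  independent there and the smaller argument falls short by a factor of at most \<open>boost\<close>, by
  concavity of the entropy; the larger one has this factor to spare.
\<close>

lemma coupling_covers_gap:
  assumes "s \<in> {0..1}" "t \<in> {0..1}"
  shows "gap s t \<le> gain * bin_entropy (both_absent correlation s t)"
proof (cases "0 < s \<and> s < 1 \<and> 0 < t \<and> t < 1")
  case False
  then have "gap s t = 0" using assms by (auto simp: gap_def bin_entropy_def)
  moreover have "0 \<le> both_absent correlation s t" "both_absent correlation s t \<le> 1"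
    using admissible_correlation assms by (force simp: admissible_def)+
  then have "0 \<le> gain * bin_entropy (both_absent correlation s t)"
    by (intro mult_nonneg_nonneg bin_entropy_nonneg) (simp add: gain_def)
  ultimately show ?thesis by simp
next
  case True
  define e where "e z = gain * bin_entropy z" for z
  have e0: "0 \<le> e z" if "0 \<le> z" "z \<le> 1" for z
    using that unfolding e_def by (intro mult_nonneg_nonneg bin_entropy_nonneg) (auto simp: gain_def)
  have geo: "e (c * x\<^sup>2) * e (c * y\<^sup>2) \<le> (e (c * (x * y)))\<^sup>2"
    if "0 < x" "0 < y" "0 < c" "c * x\<^sup>2 < 1" "c * y\<^sup>2 < 1" for c x y
    using mult_left_mono[OF bin_entropy_geometric[OF that], of "gain\<^sup>2"]
    by (simp add: e_def power2_eq_square mult_ac)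
  have gap0: "0 \<le> gap x x" if "x \<in> {0..1}" for x
    by (intro sums_le[OF _ sums_zero gap_sums[OF that that]]) simp
  have bp: "0 < boost" "1 \<le> boost" by (simp_all add: boost_def)
  have sq: "x\<^sup>2 < 1" "0 \<le> x\<^sup>2" if "0 < x" "x < 1" for x :: real
    using that by (simp_all add: power_less_one_iff)
  have bsq: "boost * x\<^sup>2 < 1" if "0 < x" "x \<le> 85/100" for x
    using power_mono[OF that(2), of 2] that by (simp add: boost_def power2_eq_square)
  have low: "gap x x \<le> e (boost * x\<^sup>2)" if "0 < x" "x \<le> 85/100" for x
    using diagonal_main[of x] that by (simp add: e_def)
  have low': "gap x x \<le> boost * e (x\<^sup>2)" if x: "0 < x" "x \<le> 85/100" for x
  proof -
    have "e (boost * x\<^sup>2) \<le> gain * (boost * bin_entropy (x\<^sup>2))"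
      unfolding e_def using bsq[OF x] bp
      by (intro mult_left_mono bin_entropy_scale_le) (auto simp: gain_def)
    then show ?thesis using low[OF x] by (simp add: e_def mult_ac)
  qed
  have high: "boost * gap x x \<le> e (x\<^sup>2)" if "85/100 \<le> x" "x \<le> 1" for x
    using boundary_high[OF that] by (simp add: e_def)
  have mixed: "gap x x * gap y y \<le> (e (x * y))\<^sup>2" if x: "0 < x" "x \<le> 85/100" and y: "85/100 \<le> y" "y < 1" for x y
  proof -
    have "gap x x * (boost * gap y y) \<le> (boost * e (x\<^sup>2)) * e (y\<^sup>2)"
      using low'[OF x] high[of y] y x gap0[of y] e0[of "x\<^sup>2"] sq[of x] bp
      by (intro mult_mono) auto
    then have "gap x x * gap y y \<le> e (x\<^sup>2) * e (y\<^sup>2)" using bp by (simp add: mult_ac)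
    also have "\<dots> \<le> (e (x * y))\<^sup>2" using geo[of x y 1] x y sq[of x] sq[of y] by simp
    finally show ?thesis .
  qed
  have "gap s s * gap t t \<le> (e (both_absent correlation s t))\<^sup>2"
  proof -
    consider "s \<le> 85/100" "t \<le> 85/100" | "s \<le> 85/100" "85/100 < t" | "85/100 < s" "t \<le> 85/100"
      | "85/100 < s" "85/100 < t" by linarith
    then show ?thesis
    proof cases
      case 1
      have "gap s s * gap t t \<le> e (boost * s\<^sup>2) * e (boost * t\<^sup>2)"
        using low[of s] low[of t] gap0[OF assms(2)] 1 True e0[of "boost * s\<^sup>2"] bsq[of s] bp
        by (intro mult_mono) auto
      also have "\<dots> \<le> (e (boost * (s * t)))\<^sup>2" using geo[of s t boost] True 1 bsq[of s] bsq[of t] bp by simp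
      finally show ?thesis using 1 by (simp add: both_absent_correlation)
    next
      case 2
      then show ?thesis using mixed[of s t] True by (simp add: both_absent_correlation)
    next
      case 3
      then show ?thesis using mixed[of t s] True by (simp add: both_absent_correlation mult.commute)
    next
      case 4
      have high': "gap x x \<le> e (x\<^sup>2)" if "85/100 < x" "x < 1" for x
        using high[of x] that mult_right_mono[OF bp(2) gap0[of x]] by auto
      have "gap s s * gap t t \<le> e (s\<^sup>2) * e (t\<^sup>2)"
        using high'[of s] high'[of t] gap0[OF assms(2)] 4 True e0[of "s\<^sup>2"] sq[of s]
        by (intro mult_mono) auto
      also have "\<dots> \<le> (e (s * t))\<^sup>2" using geo[of s t 1] True sq[of s] sq[of t] by simp
      finally show ?thesis using 4 by (simp add: both_absent_correlation)
    qed
  qed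
  then have "(gap s t)\<^sup>2 \<le> (e (both_absent correlation s t))\<^sup>2" using gap_Cauchy_Schwarz[OF assms] by linarith
  moreover have "0 \<le> both_absent correlation s t" "both_absent correlation s t \<le> 1"
    using admissible_correlation assms by (force simp: admissible_def)+
  then have "0 \<le> e (both_absent correlation s t)" by (rule e0)
  ultimately have "gap s t \<le> e (both_absent correlation s t)" by (rule power2_le_imp_le)
  then show ?thesis by (simp add: e_def)
qed

text \<open>
  Each term of the series of the gap is a nonnegative multiple of a product of a function with
  itself, to which \<open>pair_mean_square\<close> applies; under independence that inequality is an
  equality.
\<close>

lemma pair_mean_gap_mono:
  "pair_mean (\<lambda>_. 0) n (\<lambda>G H. gap (absence i G) (absence i H)) F F
   \<le> pair_mean \<psi> n (\<lambda>G H. gap (absence i G) (absence i H)) F F"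
proof -
  define \<phi> where "\<phi> k G = absence i G - absence i G ^ (k + 2)" for k and G :: "nat set set"
  define X where "X k G H = (1 / real ((k + 2) * (k + 1))) * (\<phi> k G * \<phi> k H)" for k G H
  have X: "(\<lambda>k. X k G H) sums gap (absence i G) (absence i H)" for G H
    using gap_sums[of "absence i G" "absence i H"] by (simp add: X_def \<phi>_def absence_bounds)
  show ?thesis
  proof (rule sums_le[OF _ pair_mean_sums[OF X] pair_mean_sums[OF X]])
    fix k
    have "pair_mean (\<lambda>_. 0) n (\<lambda>G H. \<phi> k G * \<phi> k H) F F \<le> pair_mean \<psi> n (\<lambda>G H. \<phi> k G * \<phi> k H) F F"
      using pair_mean_square[of n "\<phi> k" F \<psi>] by (simp add: pair_mean_independent power2_eq_square)
    then show "pair_mean (\<lambda>_. 0) n (X k) F F \<le> pair_mean \<psi> n (X k) F F"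
      unfolding X_def pair_mean_scale by (intro mult_left_mono) auto
  qed
qed

lemma prefix_mean_entropy_bound:
  assumes "family F"
  shows "2 * absence (Suc i) F * prefix_mean i (\<lambda>G. bin_entropy (absence (Suc i) G)) F
    \<le> pair_mean (\<lambda>_. 0) i (\<lambda>G H. bin_entropy (both_absent (\<lambda>_. 0) (absence (Suc i) G) (absence (Suc i) H))) F F
     + gain * pair_mean correlation i (\<lambda>G H. bin_entropy (both_absent correlation (absence (Suc i) G) (absence (Suc i) H))) F F"
proof -
  define a where "a = absence (Suc i)"
  define h where "h G = bin_entropy (a G)" for G
  have "2 * a F * prefix_mean i h F = pair_mean (\<lambda>_. 0) i (\<lambda>G H. a G * h H + h G * a H) F F"
    using prefix_mean_absence[OF assms, of i "Suc i"] by (simp add: pair_mean_add pair_mean_independent a_def)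
  also have "(\<lambda>G H. a G * h H + h G * a H) = (\<lambda>G H. bin_entropy (a G * a H) + gap (a G) (a H))"
    by (simp add: gap_def h_def fun_eq_iff mult.commute)
  also have "pair_mean (\<lambda>_. 0) i \<dots> F F = pair_mean (\<lambda>_. 0) i (\<lambda>G H. bin_entropy (a G * a H)) F F
      + pair_mean (\<lambda>_. 0) i (\<lambda>G H. gap (a G) (a H)) F F"
    by (simp add: pair_mean_add)
  also have "pair_mean (\<lambda>_. 0) i (\<lambda>G H. gap (a G) (a H)) F F \<le> pair_mean correlation i (\<lambda>G H. gap (a G) (a H)) F F"
    unfolding a_def by (rule pair_mean_gap_mono)
  also have "\<dots> \<le> pair_mean correlation i (\<lambda>G H. gain * bin_entropy (both_absent correlation (a G) (a H))) F F"
    by (intro pair_mean_mono admissible_correlation coupling_covers_gap assms) (simp_all add: a_def absence_bounds)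
  finally show ?thesis by (simp add: pair_mean_scale both_absent_def a_def h_def)
qed

section \<open>The bound on the frequencies\<close>

theorem theorem1p1:
  fixes n :: nat and F :: "nat set set"
  assumes "n \<ge> 1"
    and "F \<subseteq> Pow {1..n}"
    and "union_closed F"
    and "\<exists>A\<in>F. A \<noteq> {}"
  shows "(MAX i\<in>{1..n}. frequency F i) \<ge> 1531541 / 4000000"
proof (rule ccontr)
  assume small: "\<not> ?thesis"
  then have freq: "frequency F i < 1531541 / 4000000" if "i \<in> {1..n}" for i
  proof -
    have "frequency F i \<le> (MAX i\<in>{1..n}. frequency F i)" using that by (intro Max_ge) auto
    then show ?thesis using small by linarith
  qed
  have F: "family F" using assms(2,4) finite_subset[OF assms(2)] by (auto simp: family_def)
  have absence: "(1 + gain) / 2 < absence i F" if "i \<in> {1..n}" for i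
  proof -
    have "1 - absence i F = frequency F i"
      using absence_alt(2)[OF F, of i] F by (simp add: frequency_def containing_def family_def)
    then show ?thesis using freq[OF that] by (simp add: gain_def)
  qed
  define S where "S i = prefix_mean i (\<lambda>G. bin_entropy (absence (Suc i) G)) F" for i
  have S: "0 \<le> S i" for i
  proof -
    have "prefix_mean i (\<lambda>_. 0) F = 0" by (rule prefix_mean_vanish) simp
    moreover have "prefix_mean i (\<lambda>_. 0) F \<le> S i"
      unfolding S_def by (intro prefix_mean_mono bin_entropy_nonneg absence_bounds F)
    ultimately show ?thesis by simp
  qed
  have ln_card: "ln (card F) = (\<Sum>i<n. S i)"
    unfolding S_def by (rule entropy_chain_rule[OF F assms(2)])
  have "(\<Sum>i<n. 2 * absence (Suc i) F * S i) \<le> ln (card F) + gain * ln (card F)"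
  proof -
    \<comment> \<open>one copy of \<open>ln (card F)\<close> from the independent coupling and \<open>gain\<close> copies from the correlated one\<close>
    have "(\<Sum>i<n. 2 * absence (Suc i) F * S i)
      \<le> (\<Sum>i<n. pair_mean (\<lambda>_. 0) i (\<lambda>G H. bin_entropy (both_absent (\<lambda>_. 0) (absence (Suc i) G) (absence (Suc i) H))) F F)
       + gain * (\<Sum>i<n. pair_mean correlation i (\<lambda>G H. bin_entropy (both_absent correlation (absence (Suc i) G) (absence (Suc i) H))) F F)"
      unfolding S_def sum_distrib_left sum.distrib[symmetric]
      by (intro sum_mono prefix_mean_entropy_bound F)
    also have "\<dots> \<le> ln (card F) + gain * ln (card F)"
      by (intro add_mono mult_left_mono entropy_of_unions admissible_independent admissible_correlation F assms)
        (simp add: gain_def)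
    finally show ?thesis .
  qed
  then have le: "(\<Sum>i<n. (2 * absence (Suc i) F - (1 + gain)) * S i) \<le> 0"
    by (simp add: ln_card algebra_simps sum.distrib sum_subtractf sum_distrib_left)
  have pos: "0 < 2 * absence (Suc i) F - (1 + gain)" if "i < n" for i
    using absence[of "Suc i"] that by auto
  have nonneg: "0 \<le> (2 * absence (Suc i) F - (1 + gain)) * S i" if "i < n" for i
    by (rule mult_nonneg_nonneg[OF less_imp_le[OF pos[OF that]] S])
  have "(\<Sum>i<n. (2 * absence (Suc i) F - (1 + gain)) * S i) = 0"
    by (intro antisym le sum_nonneg nonneg) simp
  then have zero: "(2 * absence (Suc i) F - (1 + gain)) * S i = 0" if "i < n" for i
    using that nonneg sum_nonneg_eq_0_iff[of "{..<n}" "\<lambda>i. (2 * absence (Suc i) F - (1 + gain)) * S i"] by simp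
  \<comment> \<open>no element carries entropy, so the family has a single member\<close>
  have "\<forall>i<n. S i = 0"
  proof (intro allI impI)
    fix i assume "i < n"
    then show "S i = 0" using pos[of i] zero[of i] by simp
  qed
  then have "ln (real (card F)) = 0" unfolding ln_card by (intro sum.neutral) simp
  moreover have "0 < card F" using F unfolding family_def card_gt_0_iff by blast
  ultimately have "card F = 1" by (simp add: ln_eq_zero_iff)
  then obtain A where A: "F = {A}" by (rule card_1_singletonE)
  then obtain i where i: "i \<in> A" using assms(4) by blast
  have "{B \<in> F. i \<in> B} = F" using A i by blast
  then have "frequency F i = 1" unfolding frequency_def using \<open>card F = 1\<close> by (simp only:)
  moreover have "i \<in> {1..n}" using i A assms(2) by blast
  ultimately show False using freq[of i] by simp
qed

end
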